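(* Let $\nu\ge \frac12$ be real, and for integers $n\ge 2$ let $$I_{\nu}(n):=n^{\nu}\int_0^{\infty}\left(\frac{2^{\nu}\,\Gamma(\nu+1)\,|J_{\nu}(t)|}{t^{\nu}}\right)^{n}t^{2\nu-1}\,dt .$$ Set $$c_0=\frac{4^{\nu}}{2}(\nu+1)^{\nu}\,\Gamma(\nu),\qquad c_1=-\frac{4^{\nu-1}(\nu+1)^{\nu}\,\Gamma(\nu+2)}{\nu+2},$$ $$c_2=4^{\nu-2}(\nu+1)^{\nu}\,\Gamma(\nu+2)\,\frac{3\nu^{2}+2\nu-5}{3(\nu+2)(\nu+3)},$$ $$c_3=-4^{\nu-2}(\nu+1)^{\nu+1}\,\Gamma(\nu+2)\,\frac{\nu^{3}-\nu^{2}-4\nu-8}{6(\nu+2)^{2}(\nu+4)} .$$ Then for every integer $m\ge 3$ there exist real constants $c_4,\ldots,c_m$ (depending on $\nu$ but not on $n$; none are needed if $m=3$) such that $$I_{\nu}(n)=c_0+\frac{c_1}{n}+\frac{c_2}{n^{2}}+\frac{c_3}{n^{3}}+\sum_{j=4}^{m}\frac{c_j}{n^{j}}+O\left(\frac{1}{n^{m+1}}\right)\qquad\text{as } n\to\infty .$$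
   Context: $\Gamma$ is the Gamma function, and $J_\nu$ is the Bessel function of order $\nu$, $$J_{\nu}(t)=\sum_{j=0}^{\infty}(-1)^{j}\left(\frac{t}{2}\right)^{2j+\nu}\frac{1}{j!\,\Gamma(j+\nu+1)},\qquad t\ge 0 .$$ The implied constant in the $O$-term may depend on $\nu$ and $m$ but not on $n$. *)

theory Defs
  imports "HOL-Analysis.Analysis" "HOL-Library.Landau_Symbols"
begin

(* Real order and argument t >= 0.  Since 0 powr a = 0 for every a, the value at
   t = 0 is the intended one only when nu > 0; below, nu >= 1/2. *)
definition bessel_J :: "real \<Rightarrow> real \<Rightarrow> real" where
  "bessel_J \<nu> t =
     (\<Sum>j. (-1) ^ j * (t / 2) powr (2 * real j + \<nu>) * (1 / (fact j * Gamma (real j + \<nu> + 1))))"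

definition bessel_power_integral :: "real \<Rightarrow> nat \<Rightarrow> real" where
  "bessel_power_integral \<nu> n = real n powr \<nu> *
     (LINT t:{0<..}|lborel.
        (2 powr \<nu> * Gamma (\<nu> + 1) * \<bar>bessel_J \<nu> t\<bar> / t powr \<nu>) ^ n * t powr (2 * \<nu> - 1))"

definition coeff0 :: "real \<Rightarrow> real" where
  "coeff0 \<nu> = 4 powr \<nu> / 2 * (\<nu> + 1) powr \<nu> * Gamma \<nu>"

definition coeff1 :: "real \<Rightarrow> real" where
  "coeff1 \<nu> = - (4 powr (\<nu> - 1) * (\<nu> + 1) powr \<nu> * Gamma (\<nu> + 2) / (\<nu> + 2))"

definition coeff2 :: "real \<Rightarrow> real" where
  "coeff2 \<nu> = 4 powr (\<nu> - 2) * (\<nu> + 1) powr \<nu> * Gamma (\<nu> + 2) *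
     ((3 * \<nu> ^ 2 + 2 * \<nu> - 5) / (3 * (\<nu> + 2) * (\<nu> + 3)))"

definition coeff3 :: "real \<Rightarrow> real" where
  "coeff3 \<nu> = - (4 powr (\<nu> - 2) * (\<nu> + 1) powr (\<nu> + 1) * Gamma (\<nu> + 2) *
     ((\<nu> ^ 3 - \<nu> ^ 2 - 4 * \<nu> - 8) / (6 * (\<nu> + 2) ^ 2 * (\<nu> + 4))))"

end

theory Submission
  imports Defs
begin

text \<open>Up to sign the \<open>n\<close>-th power in the integrand is \<open>g (t\<^sup>2) ^ n\<close> with \<open>g\<close> entire and \<open>g 0 = 1\<close>.
  Near the origin \<open>g x = exp (- a x + x M x)\<close> with \<open>a = 1 / (4 (\<nu> + 1))\<close>, \<open>M\<close> analytic and \<open>M 0 = 0\<close>.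
  Hence \<open>g x ^ n = exp (- a n x) * (\<Sum>k. (n x) ^ k / k! * M x ^ k)\<close>, and a term \<open>(n x) ^ k x ^ i\<close>
  contributes to order \<open>n powr (- \<nu> - i)\<close>; as \<open>M ^ k\<close> vanishes to order \<open>k\<close>, only \<open>k \<le> i\<close> matters for a
  given \<open>i\<close>. Away from the origin, two monotone energies of Bessel's equation give \<open>\<bar>g\<bar> \<le> q < 1\<close> and
  \<open>x * (g x)\<^sup>2 \<le> 2 \<nu>\<close>, which makes that part exponentially small.\<close>

section \<open>The logarithm of a power series\<close>

text \<open>The difficulty is uniformity in \<open>n\<close>: \<open>n x M x\<close> need not be
  small when \<open>n x\<close> is large, so \<open>exp (n x M x)\<close> has no expansion with
  bounded error. Shrinking the neighbourhood of 0 until \<open>\<bar>M x\<bar> < a / 2\<close>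
  bounds the errors by multiples of \<open>exp (a n x / 2)\<close>. This uses up half of the
  Gaussian decay, and the remaining \<open>exp (- a n x / 2)\<close> still integrates. Apart from
  the far part of \<open>\<bar>g\<bar> ^ n\<close>, every error is thus brought into the form
  \<open>exp (- a n x / 2) * (n x) ^ k * x ^ K\<close>, of order \<open>n powr (- \<nu> - K)\<close>
  for each \<open>k\<close>. The comparison is pointwise on the whole half-line, so no tail of a
  Gaussian has to be estimated. Far out, \<open>q < 1\<close> alone is not enough, as
  \<open>q ^ n * t powr (2 \<nu> - 1)\<close> is not integrable at infinity: a fixed number of
  factors of \<open>g\<close> is spent on algebraic decay, the others on \<open>q\<close>.\<close>

definition log_quotient_fps :: "real fps \<Rightarrow> real fps" where
  "log_quotient_fps F = Abs_fps (\<lambda>i. fps_nth (fps_deriv F / F) i / real (Suc i))"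

text \<open>Comparison of coefficients in \<open>(F' / F) * F = F'\<close>, with the last summand
  isolated by \<open>F 0 = 1\<close>. The recurrence serves to compute the first coefficients
  explicitly.\<close>

lemma log_quotient_fps_nth_Suc:
  fixes F :: "real fps"
  assumes "fps_nth F 0 = 1"
  shows "fps_nth (log_quotient_fps F) n = fps_nth F (Suc n)
    - (\<Sum>i<n. real (Suc i) * fps_nth (log_quotient_fps F) i * fps_nth F (n - i)) / real (Suc n)"
proof -
  define D where "D = fps_deriv F / F"
  have "D * F = fps_deriv F"
    using assms by (simp add: D_def fps_divide_unit inverse_mult_eq_1 mult.assoc)
  then have "real (Suc n) * fps_nth F (Suc n) = fps_nth (D * F) n" by simp
  also have "\<dots> = (\<Sum>i<n. fps_nth D i * fps_nth F (n - i)) + fps_nth D n"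
  proof -
    have "{0..n} = insert n {..<n}" by auto
    then show ?thesis using assms by (simp add: fps_mult_nth)
  qed
  finally have "fps_nth D n = real (Suc n) * fps_nth F (Suc n) - (\<Sum>i<n. fps_nth D i * fps_nth F (n - i))"
    by simp
  moreover have "fps_nth D i = real (Suc i) * fps_nth (log_quotient_fps F) i" for i
    by (simp add: log_quotient_fps_def D_def del: of_nat_Suc)
  ultimately show ?thesis
    by (simp add: field_simps del: of_nat_Suc)
qed

text \<open>Formally the series is \<open>log F / x\<close>: the logarithmic derivative integrated
  termwise, with one power of \<open>x\<close> removed. Dividing coefficients by
  \<open>i + 1\<close> cannot shrink the radius of convergence. The identity follows without using a
  logarithm, since \<open>exp (- x Q x) * F x\<close> has derivative 0 near the origin.\<close>

lemma log_quotient_fps_expansion: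
  fixes F :: "real fps"
  assumes F: "fps_conv_radius F > 0" and F0: "fps_nth F 0 = 1"
  shows "fps_conv_radius (log_quotient_fps F) > 0"
    and "\<forall>\<^sub>F x in nhds 0. eval_fps F x = exp (x * eval_fps (log_quotient_fps F) x)"
proof -
  define D where "D = fps_deriv F / F"
  define Q where "Q = log_quotient_fps F"
  have D: "(\<lambda>x. eval_fps (fps_deriv F) x / eval_fps F x) has_fps_expansion D"
    unfolding D_def using F F0 fps_conv_radius_deriv[of F]
    by (intro has_fps_expansion_divide' eval_fps_has_fps_expansion) auto
  have radQ: "fps_conv_radius Q \<ge> fps_conv_radius D"
    unfolding fps_conv_radius_def
  proof (rule conv_radius_geI_ex)
    fix r :: real assume r: "0 < r" "ereal r < conv_radius (fps_nth D)"
    have "summable (\<lambda>n. norm (fps_nth D n * r ^ n))"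
      using r by (intro abs_summable_in_conv_radius) auto
    moreover have "norm (fps_nth Q n * r ^ n) \<le> norm (fps_nth D n * r ^ n)" for n
    proof -
      have "\<bar>fps_nth Q n\<bar> \<le> \<bar>fps_nth D n\<bar>"
        using mult_left_mono[of 1 "real (Suc n)" "\<bar>fps_nth D n\<bar>"]
        by (simp add: Q_def log_quotient_fps_def D_def divide_le_eq)
      then show ?thesis
        using r by (simp add: abs_mult mult_right_mono)
    qed
    ultimately have "summable (\<lambda>n. fps_nth Q n * r ^ n)"
      by (intro summable_comparison_test[of "\<lambda>n. fps_nth Q n * r ^ n"]) auto
    then show "\<exists>z. norm z = r \<and> summable (\<lambda>n. fps_nth Q n * z ^ n)"
      using r by (intro exI[of _ r]) auto
  qed
  moreover have D0: "fps_conv_radius D > 0" using D by (simp add: has_fps_expansion_def)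
  ultimately show radQ0: "fps_conv_radius (log_quotient_fps F) > 0" by (simp add: Q_def)
  have ball: "\<forall>\<^sub>F x in nhds 0. x \<in> eball 0 (fps_conv_radius G)" if "fps_conv_radius G > 0" for G :: "real fps"
    by (rule eventually_nhds_in_open) (use that in \<open>auto simp: zero_ereal_def\<close>)
  have "isCont (eval_fps F) 0"
    by (intro continuous_eval_fps) (use F in \<open>auto simp: zero_ereal_def\<close>)
  then have "(eval_fps F \<longlongrightarrow> eval_fps F 0) (nhds 0)"
    by (simp add: isCont_def tendsto_nhds_iff)
  then have pos: "\<forall>\<^sub>F x in nhds 0. eval_fps F x > 0"
    using F0 by (intro order_tendstoD(1)) (auto simp: eval_fps_at_0)
  have "\<forall>\<^sub>F x in nhds 0. eval_fps D x = eval_fps (fps_deriv F) x / eval_fps F x"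
    using D by (auto simp: has_fps_expansion_def)
  with pos ball[OF F] ball[OF radQ0[folded Q_def]] ball[OF D0]
  have "\<forall>\<^sub>F x in nhds 0. eval_fps F x > 0 \<and> x \<in> eball 0 (fps_conv_radius F) \<and> x \<in> eball 0 (fps_conv_radius Q)
     \<and> x \<in> eball 0 (fps_conv_radius D) \<and> eval_fps D x = eval_fps (fps_deriv F) x / eval_fps F x"
    by eventually_elim simp
  then obtain r where r: "r > 0" and loc: "\<And>x. x \<in> ball 0 r \<Longrightarrow> eval_fps F x > 0 \<and> x \<in> eball 0 (fps_conv_radius F)
     \<and> x \<in> eball 0 (fps_conv_radius Q)
     \<and> x \<in> eball 0 (fps_conv_radius D) \<and> eval_fps D x = eval_fps (fps_deriv F) x / eval_fps F x"
    unfolding eventually_nhds_metric by (auto simp: dist_commute)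
  \<comment> \<open>The factor \<open>fps_X\<close> restores the removed power, so differentiation
    cancels the denominators \<open>Suc i\<close>.\<close>
  have XQ: "fps_deriv (fps_X * Q) = D"
  proof (rule fps_ext)
    show "fps_nth (fps_deriv (fps_X * Q)) n = fps_nth D n" for n
      by (simp add: Q_def log_quotient_fps_def D_def del: of_nat_Suc fps_deriv_mult)
  qed
  define h where "h = (\<lambda>y. y * eval_fps Q y)"
  have const: "exp (- h x) * eval_fps F x = exp (- h 0) * eval_fps F 0"
    if x: "x \<in> ball 0 r" for x
  proof (rule DERIV_isconst3[of "- r" r x 0])
    fix y assume "y \<in> {- r<..<r}"
    then have y: "y \<in> ball 0 r" by (auto simp: dist_real_def)
    have "(h has_real_derivative eval_fps Q y + y * eval_fps (fps_deriv Q) y) (at y)"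
      unfolding h_def using loc[OF y] by (auto intro!: derivative_eq_intros has_field_derivative_eval_fps)
    also have "eval_fps Q y + y * eval_fps (fps_deriv Q) y = eval_fps D y"
    proof -
      have r1: "ereal (norm y) < fps_conv_radius (fps_deriv Q)"
        using loc[OF y] fps_conv_radius_deriv[of Q] by (auto intro: less_le_trans)
      have r2: "ereal (norm y) < fps_conv_radius (fps_X * fps_deriv Q)"
        using r1 by (intro less_le_trans[OF _ fps_conv_radius_mult]) simp
      show ?thesis
        unfolding XQ[symmetric] using loc[OF y] r1 r2 by (simp add: eval_fps_add eval_fps_mult)
    qed
    finally have d: "(h has_real_derivative eval_fps (fps_deriv F) y / eval_fps F y) (at y)"
      using loc[OF y] by simp
    show "((\<lambda>y. exp (- h y) * eval_fps F y) has_real_derivative 0) (at y)"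
      using loc[OF y]
      by (auto intro!: derivative_eq_intros d has_field_derivative_eval_fps)
  qed (use r x in \<open>auto simp: dist_real_def\<close>)
  have "eval_fps F x = exp (x * eval_fps Q x)" if x: "x \<in> ball 0 r" for x
    using const[OF x] F0 by (simp add: h_def eval_fps_at_0 exp_minus field_simps)
  moreover have "\<forall>\<^sub>F x in nhds 0. x \<in> ball 0 r"
    by (rule eventually_nhds_in_open) (use r in auto)
  ultimately show "\<forall>\<^sub>F x in nhds 0. eval_fps F x = exp (x * eval_fps (log_quotient_fps F) x)"
    unfolding Q_def[symmetric] by (auto elim: eventually_mono)
qed

section \<open>The normalised Bessel function\<close>

text \<open>The hypergeometric series 0F1 with parameter \<open>\<nu> + 1\<close> at
  \<open>- x / 4\<close>, where \<open>x\<close> stands for \<open>t\<^sup>2\<close>. Pochhammer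
  symbols replace the Gamma values because the normalisation divides out
  \<open>Gamma (\<nu> + 1)\<close>.\<close>

definition bessel_fps :: "real \<Rightarrow> real fps" where
  "bessel_fps \<nu> = Abs_fps (\<lambda>j. (- 1 / 4) ^ j / (fact j * pochhammer (\<nu> + 1) j))"

definition bessel_g :: "real \<Rightarrow> real \<Rightarrow> real" where
  "bessel_g \<nu> = eval_fps (bessel_fps \<nu>)"

lemma bessel_fps_nth_Suc:
  assumes "\<nu> > 0"
  shows "real (Suc j) * (\<nu> + 1 + real j) * fps_nth (bessel_fps \<nu>) (Suc j) = - fps_nth (bessel_fps \<nu>) j / 4"
proof -
  have "pochhammer (\<nu> + 1) j > 0" "\<nu> + 1 + real j > 0"
    using assms by (auto intro: pochhammer_pos)
  then show ?thesis
    by (simp add: bessel_fps_def pochhammer_Suc divide_simps del: of_nat_Suc)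
qed

lemma bessel_fps_0 [simp]: "fps_nth (bessel_fps \<nu>) 0 = 1"
  by (simp add: bessel_fps_def)

lemma fps_conv_radius_bessel_fps:
  assumes "\<nu> > 0"
  shows "fps_conv_radius (bessel_fps \<nu>) = \<infinity>"
  unfolding fps_conv_radius_def
proof (rule conv_radius_inftyI'')
  fix z :: real
  have "norm (fps_nth (bessel_fps \<nu>) n * z ^ n) \<le> norm z ^ n /\<^sub>R fact n" for n
  proof -
    have p: "pochhammer (\<nu> + 1) n \<ge> 1"
    proof (induction n)
      case (Suc n)
      have "1 * 1 \<le> pochhammer (\<nu> + 1) n * (\<nu> + 1 + real n)"
        using Suc assms by (intro mult_mono) auto
      then show ?case by (simp add: pochhammer_Suc)
    qed simp
    have "\<bar>fps_nth (bessel_fps \<nu>) n\<bar> = (1 / 4) ^ n / (fact n * pochhammer (\<nu> + 1) n)"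
      using p by (simp add: bessel_fps_def abs_mult power_abs)
    also have "\<dots> \<le> 1 / (fact n * 1)"
      using p by (intro frac_le mult_left_mono) (auto simp: power_le_one)
    finally have "\<bar>fps_nth (bessel_fps \<nu>) n\<bar> * \<bar>z\<bar> ^ n \<le> 1 / (fact n * 1) * \<bar>z\<bar> ^ n"
      by (intro mult_right_mono) auto
    then show ?thesis by (simp add: abs_mult power_abs divide_inverse mult.commute)
  qed
  then show "summable (\<lambda>n. fps_nth (bessel_fps \<nu>) n * z ^ n)"
    by (intro summable_comparison_test[OF _ summable_exp_generic[of "norm z"]]) auto
qed

lemma bessel_J_eq_bessel_g:
  assumes \<nu>: "\<nu> > 0" and t: "t > 0"
  shows "2 powr \<nu> * Gamma (\<nu> + 1) * \<bar>bessel_J \<nu> t\<bar> / t powr \<nu> = \<bar>bessel_g \<nu> (t\<^sup>2)\<bar>"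
proof -
  have "summable (\<lambda>j. fps_nth (bessel_fps \<nu>) j * (t\<^sup>2) ^ j)"
    by (rule summable_fps) (simp add: fps_conv_radius_bessel_fps[OF \<nu>])
  then have "(\<Sum>j. (t / 2) powr \<nu> / Gamma (\<nu> + 1) * (fps_nth (bessel_fps \<nu>) j * (t\<^sup>2) ^ j))
      = (t / 2) powr \<nu> / Gamma (\<nu> + 1) * bessel_g \<nu> (t\<^sup>2)"
    unfolding bessel_g_def eval_fps_def by (rule suminf_mult)
  moreover have "(-1) ^ j * (t / 2) powr (2 * real j + \<nu>) * (1 / (fact j * Gamma (real j + \<nu> + 1)))
      = (t / 2) powr \<nu> / Gamma (\<nu> + 1) * (fps_nth (bessel_fps \<nu>) j * (t\<^sup>2) ^ j)" for j
  proof -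
    have 1: "Gamma (real j + \<nu> + 1) = pochhammer (\<nu> + 1) j * Gamma (\<nu> + 1)"
      using \<nu> by (subst pochhammer_Gamma) (auto simp: add_ac Gamma_eq_zero_iff elim!: nonpos_Ints_cases)
    have 2: "(t / 2) powr (2 * real j + \<nu>) = (t\<^sup>2 / 4) ^ j * (t / 2) powr \<nu>"
      using t powr_realpow[of "t / 2" "2 * j"] by (simp add: powr_add power_mult power_divide)
    show ?thesis
    proof -
      have "(- 1) ^ j * (t\<^sup>2 / 4) ^ j = (- 1 / 4) ^ j * (t\<^sup>2) ^ j"
        unfolding power_mult_distrib[symmetric] by simp
      then show ?thesis
        unfolding 1 2 mult.assoc[symmetric] by (simp add: bessel_fps_def mult_ac)
    qed
  qed
  ultimately have "bessel_J \<nu> t = (t / 2) powr \<nu> / Gamma (\<nu> + 1) * bessel_g \<nu> (t\<^sup>2)"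
    by (simp add: bessel_J_def)
  moreover have "Gamma (\<nu> + 1) > 0" using \<nu> by (intro Gamma_real_pos) auto
  ultimately have "2 powr \<nu> * Gamma (\<nu> + 1) * bessel_J \<nu> t / t powr \<nu> = bessel_g \<nu> (t\<^sup>2)"
    using t by (simp add: powr_divide field_simps)
  then have "\<bar>2 powr \<nu> * Gamma (\<nu> + 1) * bessel_J \<nu> t / t powr \<nu>\<bar> = \<bar>bessel_g \<nu> (t\<^sup>2)\<bar>"
    by simp
  then show ?thesis
    using \<open>Gamma (\<nu> + 1) > 0\<close> by (simp add: abs_mult)
qed

lemma bessel_power_integral_eq:
  assumes "\<nu> > 0"
  shows "bessel_power_integral \<nu> n
    = real n powr \<nu> * (LINT t:{0<..}|lborel. \<bar>bessel_g \<nu> (t\<^sup>2)\<bar> ^ n * t powr (2 * \<nu> - 1))"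
  unfolding bessel_power_integral_def
  by (intro arg_cong2[where f = "(*)"] set_lebesgue_integral_cong refl)
    (use bessel_J_eq_bessel_g[OF assms] in auto)

text \<open>The coefficient recurrence read as a differential equation: Bessel's equation in the
  variable \<open>x\<close>. Only the product \<open>x * g2 x\<close> is described, so nothing is
  divided by \<open>x\<close> and the energies can be started at the singular point 0.\<close>

lemma bessel_g_ode:
  assumes "\<nu> > 0"
  obtains g1 g2 where "\<And>x. (bessel_g \<nu> has_real_derivative g1 x) (at x)"
    "\<And>x. (g1 has_real_derivative g2 x) (at x)"
    "\<And>x. x * g2 x = - (\<nu> + 1) * g1 x - bessel_g \<nu> x / 4"
    "bessel_g \<nu> 0 = 1" "g1 0 = - 1 / (4 * (\<nu> + 1))"
proof -
  define F where "F = bessel_fps \<nu>"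
  have rad: "fps_conv_radius F = \<infinity>"
    using fps_conv_radius_bessel_fps[OF assms] by (simp add: F_def)
  have rad1: "fps_conv_radius (fps_deriv F) = \<infinity>"
    using fps_conv_radius_deriv[of F] rad by simp
  have rad2: "fps_conv_radius (fps_deriv (fps_deriv F)) = \<infinity>"
    using fps_conv_radius_deriv[of "fps_deriv F"] rad1 by simp
  have "fps_X * fps_deriv (fps_deriv F) = fps_const (- (\<nu> + 1)) * fps_deriv F + fps_const (- 1 / 4) * F"
  proof (rule fps_ext)
    fix n
    show "fps_nth (fps_X * fps_deriv (fps_deriv F)) n
       = fps_nth (fps_const (- (\<nu> + 1)) * fps_deriv F + fps_const (- 1 / 4) * F) n"
      using bessel_fps_nth_Suc[OF assms, of n]
      by (cases n) (simp_all add: F_def algebra_simps)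
  qed
  then have ode: "eval_fps (fps_X * fps_deriv (fps_deriv F)) x
      = eval_fps (fps_const (- (\<nu> + 1)) * fps_deriv F + fps_const (- 1 / 4) * F) x" for x
    by simp
  show ?thesis
  proof (rule that)
    show "(bessel_g \<nu> has_real_derivative eval_fps (fps_deriv F) x) (at x)" for x
      unfolding bessel_g_def F_def[symmetric] by (rule has_field_derivative_eval_fps) (simp add: rad)
    show "(eval_fps (fps_deriv F) has_real_derivative eval_fps (fps_deriv (fps_deriv F)) x) (at x)" for x
      by (rule has_field_derivative_eval_fps) (simp add: rad1)
    show "x * eval_fps (fps_deriv (fps_deriv F)) x = - (\<nu> + 1) * eval_fps (fps_deriv F) x - bessel_g \<nu> x / 4" for x
    proof -
      have "fps_conv_radius (fps_const c * G) = \<infinity>" if "fps_conv_radius G = \<infinity>" for c and G :: "real fps"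
        using fps_conv_radius_mult[of "fps_const c" G] that by simp
      then show ?thesis
        using ode[of x] rad rad1 rad2
        by (simp add: eval_fps_mult eval_fps_add bessel_g_def F_def[symmetric])
    qed
    show "bessel_g \<nu> 0 = 1"
      by (simp add: bessel_g_def eval_fps_at_0)
    show "eval_fps (fps_deriv F) 0 = - 1 / (4 * (\<nu> + 1))"
      by (simp add: eval_fps_at_0 F_def bessel_fps_def)
  qed
qed

text \<open>In the variable \<open>t = sqrt x\<close> the quantity that decreases is the energy
  \<open>\<phi>\<^sup>2 + \<phi>'\<^sup>2\<close> of \<open>\<phi>'' + (2 \<nu> + 1) / t * \<phi>' + \<phi> = 0\<close>.\<close>
lemma bessel_g_bounded_away_from_1:
  assumes "\<nu> > 0" "\<delta> > 0"
  shows "\<exists>q<1. \<forall>x\<ge>\<delta>. \<bar>bessel_g \<nu> x\<bar> \<le> q"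
proof -
  obtain g1 g2 where g1: "\<And>x. (bessel_g \<nu> has_real_derivative g1 x) (at x)"
    and g2: "\<And>x. (g1 has_real_derivative g2 x) (at x)"
    and ode: "\<And>x. x * g2 x = - (\<nu> + 1) * g1 x - bessel_g \<nu> x / 4"
    and init: "bessel_g \<nu> 0 = 1" "g1 0 = - 1 / (4 * (\<nu> + 1))"
    by (rule bessel_g_ode[OF assms(1)], rule that)
  define E where "E = (\<lambda>x. (bessel_g \<nu> x)\<^sup>2 + 4 * x * (g1 x)\<^sup>2)"
  have dE: "(E has_real_derivative - (8 * \<nu> + 4) * (g1 x)\<^sup>2) (at x)" for x
  proof -
    have "(E has_real_derivative 2 * bessel_g \<nu> x * g1 x + (4 * (g1 x)\<^sup>2 + 8 * g1 x * (x * g2 x))) (at x)"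
      unfolding E_def by (auto intro!: derivative_eq_intros g1 g2)
    also have "2 * bessel_g \<nu> x * g1 x + (4 * (g1 x)\<^sup>2 + 8 * g1 x * (x * g2 x)) = - (8 * \<nu> + 4) * (g1 x)\<^sup>2"
      unfolding ode by (simp add: algebra_simps power2_eq_square)
    finally show ?thesis .
  qed
  \<comment> \<open>Monotonicity of \<open>E\<close> alone gives only the bound 1. The nonzero slope
    of \<open>g\<close> at 0 makes \<open>E\<close> drop strictly below \<open>E 0 = 1\<close> at
    once.\<close>
  have "- (8 * \<nu> + 4) * (g1 0)\<^sup>2 < 0"
    using assms init(2) by (intro mult_neg_pos) auto
  from DERIV_neg_dec_right[OF dE[of 0] this] obtain d where
    d: "d > 0" "\<And>h. 0 < h \<Longrightarrow> h < d \<Longrightarrow> E h < E 0"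
    by auto
  \<comment> \<open>A point inside the range of strict decrease and not beyond
    \<open>\<delta>\<close>; \<open>E h\<close> then bounds \<open>E\<close> on all of
    \<open>[\<delta>, \<infinity>)\<close>.\<close>
  define h where "h = min (d / 2) \<delta>"
  have h: "0 < h" "h < d" "h \<le> \<delta>" using d assms by (auto simp: h_def)
  have E0: "E 0 = 1" by (simp add: E_def init)
  have "\<bar>bessel_g \<nu> x\<bar> \<le> sqrt (E h)" if "x \<ge> \<delta>" for x
  proof (rule real_le_rsqrt)
    have "(bessel_g \<nu> x)\<^sup>2 \<le> E x" using that assms by (simp add: E_def)
    also have "E x \<le> E h"
    proof (rule DERIV_nonpos_imp_nonincreasing[of h x E])
      fix z
      have "- (8 * \<nu> + 4) * (g1 z)\<^sup>2 \<le> 0"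
        using assms by (intro mult_nonpos_nonneg) auto
      then show "\<exists>y. (E has_real_derivative y) (at z) \<and> y \<le> 0"
        using dE[of z] by blast
    qed (use h that in auto)
    finally show "\<bar>bessel_g \<nu> x\<bar>\<^sup>2 \<le> E h" by simp
  qed
  moreover have "sqrt (E h) < 1" using d(2)[OF h(1,2)] E0 by simp
  ultimately show ?thesis by blast
qed

text \<open>In the variable \<open>t = sqrt x\<close>, the function \<open>H\<close> below is
  \<open>t\<^sup>2 (\<phi>\<^sup>2 + \<phi>'\<^sup>2) + 2 t \<phi> \<phi>' + 2 \<nu> \<phi>\<^sup>2\<close>, with derivative \<open>(2 - 4 \<nu>) t \<phi>'\<^sup>2\<close>; this is
  where \<open>\<nu> \<ge> 1 / 2\<close> is needed.\<close>
lemma bessel_g_decay: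
  assumes "\<nu> \<ge> 1 / 2" "x > 0"
  shows "x * (bessel_g \<nu> x)\<^sup>2 \<le> 2 * \<nu>"
proof -
  have \<nu>: "\<nu> > 0" using assms by simp
  obtain g1 g2 where g1: "\<And>x. (bessel_g \<nu> has_real_derivative g1 x) (at x)"
    and g2: "\<And>x. (g1 has_real_derivative g2 x) (at x)"
    and ode: "\<And>x. x * g2 x = - (\<nu> + 1) * g1 x - bessel_g \<nu> x / 4"
    and init: "bessel_g \<nu> 0 = 1" "g1 0 = - 1 / (4 * (\<nu> + 1))"
    by (rule bessel_g_ode[OF \<nu>], rule that)
  define H where "H = (\<lambda>x. x * (bessel_g \<nu> x)\<^sup>2 + 4 * (x * g1 x)\<^sup>2 + 4 * x * bessel_g \<nu> x * g1 x + 2 * \<nu> * (bessel_g \<nu> x)\<^sup>2)"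
  have dH: "(H has_real_derivative (4 - 8 * \<nu>) * x * (g1 x)\<^sup>2) (at x)" for x
  proof -
    have "(H has_real_derivative (bessel_g \<nu> x)\<^sup>2 + 2 * x * bessel_g \<nu> x * g1 x + 8 * x * g1 x * (g1 x + x * g2 x)
        + 4 * bessel_g \<nu> x * g1 x + 4 * x * (g1 x)\<^sup>2 + 4 * bessel_g \<nu> x * (x * g2 x) + 4 * \<nu> * bessel_g \<nu> x * g1 x) (at x)"
      unfolding H_def
      by (auto intro!: derivative_eq_intros g1 g2 simp: algebra_simps power2_eq_square)
    also have "(bessel_g \<nu> x)\<^sup>2 + 2 * x * bessel_g \<nu> x * g1 x + 8 * x * g1 x * (g1 x + x * g2 x)
        + 4 * bessel_g \<nu> x * g1 x + 4 * x * (g1 x)\<^sup>2 + 4 * bessel_g \<nu> x * (x * g2 x) + 4 * \<nu> * bessel_g \<nu> x * g1 x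
        = (4 - 8 * \<nu>) * x * (g1 x)\<^sup>2"
      unfolding ode by (simp add: algebra_simps power2_eq_square)
    finally show ?thesis .
  qed
  have "H x \<le> H 0"
  proof (rule DERIV_nonpos_imp_nonincreasing[of 0 x H])
    fix z :: real assume z: "0 \<le> z"
    have "(4 - 8 * \<nu>) * z * (g1 z)\<^sup>2 \<le> 0"
      using z assms by (intro mult_nonpos_nonneg) auto
    then show "\<exists>y. (H has_real_derivative y) (at z) \<and> y \<le> 0"
      using dH[of z] by blast
  qed (use assms in auto)
  \<comment> \<open>Completing the square in \<open>H\<close> takes one \<open>g\<^sup>2\<close> out
    of \<open>2 * \<nu> * g\<^sup>2\<close>; the rest, with factor \<open>2 * \<nu> - 1\<close>, is
    still nonnegative. The right-hand side is \<open>H 0\<close>.\<close>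
  then have "x * (bessel_g \<nu> x)\<^sup>2 + (2 * x * g1 x + bessel_g \<nu> x)\<^sup>2 + (2 * \<nu> - 1) * (bessel_g \<nu> x)\<^sup>2 \<le> 2 * \<nu>"
    by (simp add: H_def init algebra_simps power2_eq_square)
  moreover have "(2 * \<nu> - 1) * (bessel_g \<nu> x)\<^sup>2 \<ge> 0" "(2 * x * g1 x + bessel_g \<nu> x)\<^sup>2 \<ge> 0"
    using assms by auto
  ultimately show ?thesis by linarith
qed

section \<open>Coefficients\<close>

text \<open>The Gamma quotient is the integral of
  \<open>exp (- a t\<^sup>2) * t powr (2 s - 1)\<close> over \<open>t > 0\<close> with
  \<open>s = \<nu> + k + i\<close>; the power of \<open>n\<close> has been scaled out.\<close>

definition laplace_coeff :: "real \<Rightarrow> real \<Rightarrow> real fps \<Rightarrow> nat \<Rightarrow> real" where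
  "laplace_coeff a \<nu> F i =
     (\<Sum>k\<le>i. fps_nth (F ^ k) i / fact k * (Gamma (\<nu> + k + i) / (2 * a powr (\<nu> + k + i))))"

text \<open>The series of \<open>M\<close>. The added constant cancels the linear term of
  \<open>log g\<close>, which goes into the Gaussian instead.\<close>

definition bessel_log_fps :: "real \<Rightarrow> real fps" where
  "bessel_log_fps \<nu> = fps_const (1 / (4 * (\<nu> + 1))) + log_quotient_fps (bessel_fps \<nu>)"

text \<open>These are \<open>-\<sigma>\<^sub>k / k\<close> for \<open>k = 2, 3, 4\<close>, where \<open>\<sigma>\<^sub>k\<close> is the sum of the \<open>(-2 k)\<close>-th powers
  of the positive zeros of \<open>J\<^sub>\<nu>\<close> (Rayleigh).\<close>
lemma bessel_log_fps_nth:
  assumes "\<nu> > 0"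
  shows "fps_nth (bessel_log_fps \<nu>) 0 = 0"
    and "fps_nth (bessel_log_fps \<nu>) 1 = - 1 / (32 * (\<nu> + 1) ^ 2 * (\<nu> + 2))"
    and "fps_nth (bessel_log_fps \<nu>) 2 = - 1 / (96 * (\<nu> + 1) ^ 3 * (\<nu> + 2) * (\<nu> + 3))"
    and "fps_nth (bessel_log_fps \<nu>) 3
      = - (5 * \<nu> + 11) / (1024 * (\<nu> + 1) ^ 4 * (\<nu> + 2) ^ 2 * (\<nu> + 3) * (\<nu> + 4))"
proof -
  define c where "c = fps_nth (bessel_fps \<nu>)"
  define l where "l = fps_nth (log_quotient_fps (bessel_fps \<nu>))"
  have pos: "\<nu> + 1 > 0" "\<nu> + 2 > 0" "\<nu> + 3 > 0" "\<nu> + 4 > 0" using assms by auto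
  have c: "c 1 = - 1 / (4 * (\<nu> + 1))" "c 2 = 1 / (32 * (\<nu> + 1) * (\<nu> + 2))"
    "c 3 = - 1 / (384 * (\<nu> + 1) * (\<nu> + 2) * (\<nu> + 3))"
    "c 4 = 1 / (6144 * (\<nu> + 1) * (\<nu> + 2) * (\<nu> + 3) * (\<nu> + 4))"
    by (simp_all add: c_def bessel_fps_def pochhammer_Suc eval_nat_numeral fact_numeral add_ac)
  have rec: "l n = c (Suc n) - (\<Sum>i<n. real (Suc i) * l i * c (n - i)) / real (Suc n)" for n
    unfolding l_def c_def by (rule log_quotient_fps_nth_Suc) simp
  have l0: "l 0 = c 1" using rec[of 0] by simp
  have l1: "l 1 = c 2 - l 0 * c 1 / 2" using rec[of 1] by (simp add: numeral_2_eq_2)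
  have l2: "l 2 = c 3 - (l 0 * c 2 + 2 * l 1 * c 1) / 3"
    using rec[of 2] by (simp add: eval_nat_numeral)
  have l3: "l 3 = c 4 - (l 0 * c 3 + 2 * l 1 * c 2 + 3 * l 2 * c 1) / 4"
    using rec[of 3] by (simp add: eval_nat_numeral)
  show "fps_nth (bessel_log_fps \<nu>) 0 = 0"
    using l0 c(1) by (simp add: bessel_log_fps_def l_def)
  have v1: "l 1 = - 1 / (32 * (\<nu> + 1) ^ 2 * (\<nu> + 2))"
    unfolding l1 l0 c using pos by (simp add: divide_simps) algebra
  have v2: "l 2 = - 1 / (96 * (\<nu> + 1) ^ 3 * (\<nu> + 2) * (\<nu> + 3))"
    unfolding l2 v1 l0 c using pos by (simp add: divide_simps) algebra
  have v3: "l 3 = - (5 * \<nu> + 11) / (1024 * (\<nu> + 1) ^ 4 * (\<nu> + 2) ^ 2 * (\<nu> + 3) * (\<nu> + 4))"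
    unfolding l3 v2 v1 l0 c using pos by (simp add: divide_simps) algebra
  show "fps_nth (bessel_log_fps \<nu>) 1 = - 1 / (32 * (\<nu> + 1) ^ 2 * (\<nu> + 2))"
    and "fps_nth (bessel_log_fps \<nu>) 2 = - 1 / (96 * (\<nu> + 1) ^ 3 * (\<nu> + 2) * (\<nu> + 3))"
    and "fps_nth (bessel_log_fps \<nu>) 3
      = - (5 * \<nu> + 11) / (1024 * (\<nu> + 1) ^ 4 * (\<nu> + 2) ^ 2 * (\<nu> + 3) * (\<nu> + 4))"
    using v1 v2 v3 by (simp_all add: bessel_log_fps_def l_def)
qed

text \<open>For \<open>i \<ge> 1\<close> the term \<open>k = 0\<close> vanishes, as
  \<open>F ^ 0 = 1\<close>, and all others have \<open>k + i \<ge> 2\<close>. Hence every Gamma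
  value is a polynomial multiple of \<open>Gamma (\<nu> + 2)\<close> and every power of
  \<open>a\<close> a multiple of \<open>W\<close>, which leaves identities between rational
  functions of \<open>\<nu>\<close>.\<close>

lemma bessel_laplace_coeff:
  assumes "\<nu> > 0"
  defines "a \<equiv> 1 / (4 * (\<nu> + 1))"
  shows "laplace_coeff a \<nu> (bessel_log_fps \<nu>) 0 = coeff0 \<nu>"
    and "laplace_coeff a \<nu> (bessel_log_fps \<nu>) 1 = coeff1 \<nu>"
    and "laplace_coeff a \<nu> (bessel_log_fps \<nu>) 2 = coeff2 \<nu>"
    and "laplace_coeff a \<nu> (bessel_log_fps \<nu>) 3 = coeff3 \<nu>"
proof -
  define F where "F = bessel_log_fps \<nu>"
  define l1 l2 l3 where "l1 = fps_nth F 1" and "l2 = fps_nth F 2" and "l3 = fps_nth F 3"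
  define W where "W = 4 powr \<nu> * (\<nu> + 1) powr \<nu>"
  define G where "G = Gamma (\<nu> + 2)"
  have pos: "\<nu> + 1 > 0" "\<nu> + 2 > 0" "\<nu> + 3 > 0" "\<nu> + 4 > 0" using assms by auto
  have F0: "fps_nth F 0 = 0" using bessel_log_fps_nth(1)[OF assms(1)] by (simp add: F_def)
  note l = bessel_log_fps_nth(2-4)[OF assms(1), folded F_def, folded l1_def l2_def l3_def]
  have sq: "fps_nth (F ^ 2) 2 = l1 ^ 2" "fps_nth (F ^ 2) 3 = 2 * l1 * l2"
    and cube: "fps_nth (F ^ 3) 3 = l1 ^ 3"
    using F0 unfolding power2_eq_square power3_eq_cube l1_def l2_def
    by (simp_all add: fps_mult_nth eval_nat_numeral)
  have Gam: "Gamma (\<nu> + 2 + real k) = pochhammer (\<nu> + 2) k * G" for k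
    using assms unfolding G_def
    by (subst pochhammer_Gamma) (auto simp: Gamma_eq_zero_iff elim!: nonpos_Ints_cases)
  have powr_a: "a powr (\<nu> + real k) = 1 / (W * (4 * (\<nu> + 1)) ^ k)" for k
  proof -
    have "a powr (\<nu> + real k) = 1 / (4 * (\<nu> + 1)) powr (\<nu> + real k)"
      using pos by (simp add: a_def powr_divide)
    also have "(4 * (\<nu> + 1)) powr (\<nu> + real k) = W * (4 * (\<nu> + 1)) ^ k"
      using pos powr_mult[of 4 "\<nu> + 1" \<nu>] powr_realpow[of "4 * (\<nu> + 1)" k]
      by (simp add: W_def powr_add del: distrib_left_numeral)
    finally show ?thesis .
  qed
  define T where "T = (\<lambda>k i. Gamma (\<nu> + real k + real i) / (2 * a powr (\<nu> + real k + real i)))"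
  have lc: "laplace_coeff a \<nu> F i = (\<Sum>k\<le>i. fps_nth (F ^ k) i / fact k * T k i)" for i
    by (simp add: laplace_coeff_def T_def)
  have T: "T k i = pochhammer (\<nu> + 2) j * G * W * (4 * (\<nu> + 1)) ^ (j + 2) / 2" if "k + i = j + 2" for k i j
  proof -
    have "\<nu> + real k + real i = \<nu> + 2 + real j" "\<nu> + 2 + real j = \<nu> + real (j + 2)"
      using that by linarith+
    then have "Gamma (\<nu> + real k + real i) = pochhammer (\<nu> + 2) j * G"
      "a powr (\<nu> + real k + real i) = 1 / (W * (4 * (\<nu> + 1)) ^ (j + 2))"
      using Gam[of j] powr_a[of "j + 2"] by metis+
    then show ?thesis by (simp add: T_def)
  qed
  have poch: "pochhammer (\<nu> + 2) 1 = \<nu> + 2" "pochhammer (\<nu> + 2) 2 = (\<nu> + 2) * (\<nu> + 3)"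
    "pochhammer (\<nu> + 2) 3 = (\<nu> + 2) * (\<nu> + 3) * (\<nu> + 4)"
    "pochhammer (\<nu> + 2) 4 = (\<nu> + 2) * (\<nu> + 3) * (\<nu> + 4) * (\<nu> + 5)"
    by (simp_all add: eval_nat_numeral pochhammer_Suc add_ac)
  have upto: "{..1} = {0, 1 :: nat}" "{..2} = {0, 1, 2 :: nat}" "{..3} = {0, 1, 2, 3 :: nat}" by auto
  have four: "4 powr (\<nu> - 1) = 4 powr \<nu> / 4" "4 powr (\<nu> - 2) = 4 powr \<nu> / 16"
    by (simp_all add: powr_diff)
  have "laplace_coeff a \<nu> F 0 = Gamma \<nu> / (2 * a powr \<nu>)"
    by (simp add: laplace_coeff_def)
  then show "laplace_coeff a \<nu> (bessel_log_fps \<nu>) 0 = coeff0 \<nu>"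
    using powr_a[of 0] by (simp add: coeff0_def F_def W_def)
  have T12: "T 1 2 = (\<nu> + 2) * G * W * (4 * (\<nu> + 1)) ^ 3 / 2"
    using T[of 1 2 1] unfolding poch by (simp add: power3_eq_cube)
  have T22: "T 2 2 = (\<nu> + 2) * (\<nu> + 3) * G * W * (4 * (\<nu> + 1)) ^ 4 / 2"
    and T13: "T 1 3 = (\<nu> + 2) * (\<nu> + 3) * G * W * (4 * (\<nu> + 1)) ^ 4 / 2"
    and T23: "T 2 3 = (\<nu> + 2) * (\<nu> + 3) * (\<nu> + 4) * G * W * (4 * (\<nu> + 1)) ^ 5 / 2"
    and T33: "T 3 3 = (\<nu> + 2) * (\<nu> + 3) * (\<nu> + 4) * (\<nu> + 5) * G * W * (4 * (\<nu> + 1)) ^ 6 / 2"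
    using T[of 2 2 2] T[of 1 3 2] T[of 2 3 3] T[of 3 3 4] unfolding poch by simp_all
  have "laplace_coeff a \<nu> F 1 = l1 * T 1 1"
    by (simp add: lc upto(1)[simplified] l1_def)
  also have "\<dots> = l1 * (G * W * (4 * (\<nu> + 1)) ^ 2 / 2)"
    using T[of 1 1 0] by (simp add: numeral_2_eq_2)
  also have "\<dots> = coeff1 \<nu>"
    unfolding l coeff1_def four W_def G_def[symmetric] using pos
    by (simp add: divide_simps) algebra
  finally show "laplace_coeff a \<nu> (bessel_log_fps \<nu>) 1 = coeff1 \<nu>"
    by (simp add: F_def)
  have "laplace_coeff a \<nu> F 2 = l2 * T 1 2 + l1 ^ 2 / 2 * T 2 2"
    unfolding lc upto using sq by (simp add: l2_def)
  also have "\<dots> = coeff2 \<nu>"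
    unfolding T12 T22 l coeff2_def four W_def G_def[symmetric] using pos
    by (simp add: divide_simps) algebra
  finally show "laplace_coeff a \<nu> (bessel_log_fps \<nu>) 2 = coeff2 \<nu>"
    by (simp add: F_def)
  have "laplace_coeff a \<nu> F 3 = l3 * T 1 3 + 2 * l1 * l2 / 2 * T 2 3 + l1 ^ 3 / 6 * T 3 3"
    unfolding lc upto using sq cube by (simp add: l3_def fact_numeral)
  also have "\<dots> = coeff3 \<nu>"
    unfolding T13 T23 T33 l coeff3_def four W_def G_def[symmetric] powr_add powr_one[OF less_imp_le[OF pos(1)]] using pos
    by (simp add: divide_simps) algebra
  finally show "laplace_coeff a \<nu> (bessel_log_fps \<nu>) 3 = coeff3 \<nu>"
    by (simp add: F_def)
qed

section \<open>Gaussian moments and power series remainders\<close>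

text \<open>Beyond the partial sum the series is \<open>x ^ K\<close> times the shifted series,
  which is continuous at 0 and hence bounded nearby.\<close>

lemma fps_expansion_remainder:
  fixes f :: "real \<Rightarrow> real"
  assumes "f has_fps_expansion F"
  shows "\<exists>C. \<forall>\<^sub>F x in nhds 0. \<bar>f x - (\<Sum>i<K. fps_nth F i * x ^ i)\<bar> \<le> C * \<bar>x\<bar> ^ K"
proof -
  define R where "R = fps_shift K F"
  have rad: "fps_conv_radius F > 0" and ev: "\<forall>\<^sub>F x in nhds 0. eval_fps F x = f x"
    using assms by (auto simp: has_fps_expansion_def)
  have radR: "fps_conv_radius R > 0"
    using rad by (simp add: R_def)
  have split: "eval_fps F x = (\<Sum>i<K. fps_nth F i * x ^ i) + x ^ K * eval_fps R x"
    if "ereal (norm x) < fps_conv_radius F" for x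
  proof -
    have "summable (\<lambda>i. fps_nth F i * x ^ i)" using that by (rule summable_fps)
    then have "eval_fps F x = (\<Sum>i. fps_nth F (i + K) * x ^ (i + K)) + (\<Sum>i<K. fps_nth F i * x ^ i)"
      unfolding eval_fps_def by (rule suminf_split_initial_segment)
    moreover have "(\<Sum>i. fps_nth F (i + K) * x ^ (i + K)) = x ^ K * eval_fps R x"
      unfolding eval_fps_def R_def using that
      by (subst suminf_mult [symmetric])
        (auto simp: power_add mult_ac intro!: summable_fps[of x "fps_shift K F", simplified])
    ultimately show ?thesis by simp
  qed
  have "isCont (eval_fps R) 0"
    by (intro continuous_eval_fps) (use radR in \<open>auto simp: zero_ereal_def\<close>)
  then have "(eval_fps R \<longlongrightarrow> eval_fps R 0) (nhds 0)"
    by (simp add: isCont_def tendsto_nhds_iff)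
  then have "\<forall>\<^sub>F x in nhds 0. \<bar>eval_fps R x\<bar> < \<bar>eval_fps R 0\<bar> + 1"
    by (intro order_tendstoD(2)[OF tendsto_rabs]) auto
  moreover have "\<forall>\<^sub>F x in nhds 0. x \<in> eball 0 (fps_conv_radius F)"
    by (rule eventually_nhds_in_open) (use rad in \<open>auto simp: zero_ereal_def\<close>)
  ultimately have "\<forall>\<^sub>F x in nhds 0. \<bar>f x - (\<Sum>i<K. fps_nth F i * x ^ i)\<bar> \<le> (\<bar>eval_fps R 0\<bar> + 1) * \<bar>x\<bar> ^ K"
    using ev
  proof eventually_elim
    case (elim x)
    then have "f x - (\<Sum>i<K. fps_nth F i * x ^ i) = x ^ K * eval_fps R x"
      using split[of x] by simp
    then show ?case
      using mult_right_mono[of "\<bar>eval_fps R x\<bar>" "\<bar>eval_fps R 0\<bar> + 1" "\<bar>x\<bar> ^ K"] elim(1)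
      by (simp add: abs_mult power_abs mult.commute)
  qed
  then show ?thesis by blast
qed

text \<open>The substitution \<open>u = c t\<^sup>2\<close> in Euler's integral for
  \<open>Gamma s\<close>.\<close>

lemma gaussian_moment:
  fixes c s :: real
  assumes "c > 0" "s > 0"
  shows "set_integrable lborel {0<..} (\<lambda>t. exp (- c * t\<^sup>2) * t powr (2 * s - 1))" (is ?int)
    and "(LINT t:{0<..}|lborel. exp (- c * t\<^sup>2) * t powr (2 * s - 1)) = Gamma s / (2 * c powr s)"
proof -
  define f where "f = (\<lambda>u::real. u powr (s - 1) / exp u)"
  define F where "F = (\<lambda>t::real. exp (- c * t\<^sup>2) * t powr (2 * s - 1))"
  have hi: "(f has_integral Gamma s) {0<..}"
    using Gamma_integral_real[OF assms(2)]
    by (subst has_integral_spike_set_eq[of _ "{0..}"])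
      (auto simp: f_def intro: negligible_subset[of "{0}"])
  have img: "(\<lambda>t. c * t\<^sup>2) ` {0<..} = {0<..}"
  proof (intro equalityI subsetI)
    fix u :: real assume "u \<in> {0<..}"
    then show "u \<in> (\<lambda>t. c * t\<^sup>2) ` {0<..}"
      using assms by (intro image_eqI[of _ _ "sqrt (u / c)"]) auto
  qed (use assms in auto)
  have inj: "inj_on (\<lambda>t. c * t\<^sup>2) {0<..}"
    using assms by (auto simp: inj_on_def power2_eq_iff)
  have fabs: "f absolutely_integrable_on {0<..}"
    using hi by (intro nonnegative_absolutely_integrable_1) (auto simp: f_def integrable_on_def)
  have "(\<lambda>t. \<bar>2 * c * t\<bar> * f (c * t\<^sup>2)) absolutely_integrable_on {0<..} \<and>
      integral {0<..} (\<lambda>t. \<bar>2 * c * t\<bar> * f (c * t\<^sup>2)) = Gamma s"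
    by (subst has_absolute_integral_change_of_variables_1')
      (use inj img fabs hi in \<open>auto intro!: derivative_eq_intros simp: integral_unique\<close>)
  moreover have eq: "\<bar>2 * c * t\<bar> * f (c * t\<^sup>2) = 2 * c powr s * F t" if "t \<in> {0<..}" for t
  proof -
    have "t powr (2 * s - 1) = t * (t\<^sup>2) powr (s - 1)"
      using that by (simp add: powr_powr powr_diff powr_add flip: powr_numeral)
         (simp add: field_simps power2_eq_square)
    moreover have "c powr s = c * c powr (s - 1)"
      using assms by (simp add: powr_diff)
    ultimately show ?thesis
      using that assms by (simp add: f_def F_def powr_mult exp_minus divide_inverse mult_ac)
  qed
  moreover have "(\<lambda>t. \<bar>2 * c * t\<bar> * f (c * t\<^sup>2)) absolutely_integrable_on {0<..}
      \<longleftrightarrow> (\<lambda>t. 2 * c powr s * F t) absolutely_integrable_on {0<..}"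
    by (rule set_integrable_cong) (use eq in auto)
  moreover have "integral {0<..} (\<lambda>t. \<bar>2 * c * t\<bar> * f (c * t\<^sup>2)) = integral {0<..} (\<lambda>t. 2 * c powr s * F t)"
    by (rule integral_cong) (use eq in auto)
  ultimately have "(\<lambda>t. 2 * c powr s * F t) absolutely_integrable_on {0<..}"
      and I: "integral {0<..} (\<lambda>t. 2 * c powr s * F t) = Gamma s"
    by metis+
  then have "F absolutely_integrable_on {0<..}"
    using assms set_integrable_mult_right_iff[of "2 * c powr s" lebesgue "{0<..}" F] by simp
  then show *: ?int
    unfolding set_integrable_def F_def
    by (subst (asm) integrable_completion) auto
  have "(LINT t:{0<..}|lborel. F t) = integral {0<..} F"
    using * by (intro set_borel_integral_eq_integral) (simp add: F_def)
  moreover have "2 * c powr s * integral {0<..} F = Gamma s"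
    using I by simp
  ultimately show "(LINT t:{0<..}|lborel. exp (- c * t\<^sup>2) * t powr (2 * s - 1)) = Gamma s / (2 * c powr s)"
    using assms by (simp add: F_def field_simps)
qed

lemma gaussian_moment_power:
  fixes c s :: real
  assumes "c > 0" "s > 0"
  shows "set_integrable lborel {0<..} (\<lambda>t. exp (- c * t\<^sup>2) * (t\<^sup>2) ^ m * t powr (2 * s - 1))"
    and "(LINT t:{0<..}|lborel. exp (- c * t\<^sup>2) * (t\<^sup>2) ^ m * t powr (2 * s - 1))
      = Gamma (s + m) / (2 * c powr (s + m))"
proof -
  have eq: "exp (- c * t\<^sup>2) * t powr (2 * (s + m) - 1) = exp (- c * t\<^sup>2) * (t\<^sup>2) ^ m * t powr (2 * s - 1)"
    if "t \<in> {0<..}" for t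
  proof -
    have "(t\<^sup>2) ^ m = t powr (2 * m)"
      using that powr_realpow[of t "2 * m"] by (simp add: power_mult)
    then show ?thesis
      by (simp add: algebra_simps flip: powr_add)
  qed
  have pos: "s + m > 0" using assms by simp
  show "set_integrable lborel {0<..} (\<lambda>t. exp (- c * t\<^sup>2) * (t\<^sup>2) ^ m * t powr (2 * s - 1))"
    using gaussian_moment(1)[OF assms(1) pos]
    by (rule iffD1[OF set_integrable_cong, rotated 3]) (use eq in auto)
  show "(LINT t:{0<..}|lborel. exp (- c * t\<^sup>2) * (t\<^sup>2) ^ m * t powr (2 * s - 1))
      = Gamma (s + m) / (2 * c powr (s + m))"
    unfolding gaussian_moment(2)[OF assms(1) pos, symmetric]
    by (intro set_lebesgue_integral_cong) (use eq in auto)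
qed

section \<open>Tails: integrable powers and geometric decay\<close>

lemma set_integrable_powr_to_inf:
  fixes r e :: real
  assumes "r > 0" "e < -1"
  shows "set_integrable lborel {r..} (\<lambda>t. t powr e)"
proof -
  have "(\<lambda>t. t powr e) absolutely_integrable_on {r..}"
    using has_integral_powr_to_inf[OF assms(2,1)]
    by (intro nonnegative_absolutely_integrable_1) (auto simp: integrable_on_def)
  then show ?thesis
    unfolding set_integrable_def by (subst (asm) integrable_completion) auto
qed

text \<open>With \<open>q = r ^ m\<close> the product is the \<open>m\<close>-th power of
  \<open>n * r ^ n\<close>, which tends to 0.\<close>

lemma power_times_geometric_bounded:
  fixes q :: real
  assumes "0 < q" "q < 1"
  shows "\<exists>C\<ge>0. \<forall>n. real n ^ m * q ^ n \<le> C"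
proof (cases "m = 0")
  case True
  then show ?thesis using assms by (intro exI[of _ 1]) (auto simp: power_le_one)
next
  case False
  define r where "r = root m q"
  have r: "0 < r" "r < 1" "r ^ m = q"
    using False assms by (auto simp: r_def)
  have "(\<lambda>n. real n * r ^ n) \<longlonglongrightarrow> 0"
    using powser_times_n_limit_0[of r] r by simp
  then have "Bseq (\<lambda>n. real n * r ^ n)"
    by (intro convergent_imp_Bseq convergentI)
  then obtain C where "\<forall>n. norm (real n * r ^ n) \<le> C"
    by (rule BseqE)
  then have C: "real n * r ^ n \<le> C" for n
    unfolding real_norm_def by (blast intro: abs_le_D1)
  have "real n ^ m * q ^ n \<le> C ^ m" for n
  proof -
    have "real n ^ m * q ^ n = (real n * r ^ n) ^ m"
      unfolding r(3)[symmetric] by (simp add: power_mult_distrib mult.commute flip: power_mult)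
    also have "\<dots> \<le> C ^ m"
      using C r by (intro power_mono) auto
    finally show ?thesis .
  qed
  moreover from this[of 0] have "0 \<le> C ^ m" using C[of 0] by simp
  ultimately show ?thesis by blast
qed

section \<open>Laplace expansion\<close>

lemma gaussian_moment_power_has_integral:
  fixes c s :: real
  assumes "c > 0" "s > 0"
  shows "has_bochner_integral lborel
    (\<lambda>t. indicator {0<..} t * (exp (- c * t\<^sup>2) * (t\<^sup>2) ^ m * t powr (2 * s - 1)))
    (Gamma (s + m) / (2 * c powr (s + m)))"
  using gaussian_moment_power[OF assms, of m]
  by (simp add: has_bochner_integral_iff set_integrable_def set_lebesgue_integral_def)

text \<open>Each monomial is a moment with \<open>c = a n\<close>; its \<open>n ^ k\<close> cancels
  against the scaling and leaves \<open>n powr (- \<nu> - i)\<close>. For \<open>i < K\<close> the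
  entries with \<open>k > i\<close> are zero because \<open>F ^ k\<close> starts at order
  \<open>k\<close>, so the square truncation in \<open>k\<close> and \<open>i\<close> contains each
  coefficient in full.\<close>

lemma laplace_main_term:
  fixes a \<nu> :: real
  assumes F0: "fps_nth F 0 = 0" and a: "a > 0" and \<nu>: "\<nu> > 0" and n: "n > 0"
  shows "has_bochner_integral lborel
    (\<lambda>t. indicator {0<..} t * (exp (- a * real n * t\<^sup>2)
       * (\<Sum>k<K. (real n * t\<^sup>2) ^ k / fact k * (\<Sum>i<K. fps_nth (F ^ k) i * (t\<^sup>2) ^ i)) * t powr (2 * \<nu> - 1)))
    (real n powr (- \<nu>) * (\<Sum>i<K. laplace_coeff a \<nu> F i / real n ^ i))"
proof -
  define d where "d = (\<lambda>k i. real n ^ k / fact k * fps_nth (F ^ k) i)"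
  have hb: "has_bochner_integral lborel
    (\<lambda>t. \<Sum>i<K. \<Sum>k<K. d k i * (indicator {0<..} t * (exp (- (a * n) * t\<^sup>2) * (t\<^sup>2) ^ (k + i) * t powr (2 * \<nu> - 1))))
    (\<Sum>i<K. \<Sum>k<K. d k i * (Gamma (\<nu> + (k + i)) / (2 * (a * n) powr (\<nu> + (k + i)))))"
    using gaussian_moment_power_has_integral[of "a * n" \<nu>] a n \<nu>
    by (intro has_bochner_integral_sum has_bochner_integral_mult_right) (simp_all del: of_nat_add)
  have "(\<Sum>i<K. \<Sum>k<K. d k i * (indicator {0<..} t * (exp (- (a * n) * t\<^sup>2) * (t\<^sup>2) ^ (k + i) * t powr (2 * \<nu> - 1))))
     = indicator {0<..} t * (exp (- a * real n * t\<^sup>2)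
       * (\<Sum>k<K. (real n * t\<^sup>2) ^ k / fact k * (\<Sum>i<K. fps_nth (F ^ k) i * (t\<^sup>2) ^ i)) * t powr (2 * \<nu> - 1))" for t
    unfolding sum_distrib_left sum_distrib_right
    by (subst sum.swap, intro sum.cong refl) (simp add: d_def power_add power_mult_distrib)
  moreover have "(\<Sum>i<K. \<Sum>k<K. d k i * (Gamma (\<nu> + (k + i)) / (2 * (a * n) powr (\<nu> + (k + i)))))
     = real n powr (- \<nu>) * (\<Sum>i<K. laplace_coeff a \<nu> F i / real n ^ i)"
  proof -
    have "(\<Sum>k<K. d k i * (Gamma (\<nu> + (k + i)) / (2 * (a * n) powr (\<nu> + (k + i)))))
        = real n powr (- \<nu>) * (laplace_coeff a \<nu> F i / real n ^ i)" if i: "i < K" for i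
    proof -
      have "(\<Sum>k<K. d k i * (Gamma (\<nu> + (k + i)) / (2 * (a * n) powr (\<nu> + (k + i)))))
        = (\<Sum>k\<le>i. d k i * (Gamma (\<nu> + (k + i)) / (2 * (a * n) powr (\<nu> + (k + i)))))"
        using i startsby_zero_power_prefix[OF F0]
        by (intro sum.mono_neutral_right) (auto simp: d_def)
      also have "\<dots> = (\<Sum>k\<le>i. real n powr (- \<nu>) / real n ^ i *
           (fps_nth (F ^ k) i / fact k * (Gamma (\<nu> + k + i) / (2 * a powr (\<nu> + k + i)))))"
      proof (intro sum.cong refl)
        fix k
        have "(a * n) powr (\<nu> + (k + i)) = a powr (\<nu> + k + i) * (real n powr \<nu> * real n ^ k * real n ^ i)"
          using a n by (simp add: powr_mult powr_add powr_realpow add.assoc)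
        then show "d k i * (Gamma (\<nu> + (k + i)) / (2 * (a * n) powr (\<nu> + (k + i))))
          = real n powr (- \<nu>) / real n ^ i *
           (fps_nth (F ^ k) i / fact k * (Gamma (\<nu> + k + i) / (2 * a powr (\<nu> + k + i))))"
          using a n by (simp add: d_def powr_minus field_simps)
      qed
      also have "\<dots> = real n powr (- \<nu>) * (laplace_coeff a \<nu> F i / real n ^ i)"
        by (simp only: laplace_coeff_def sum_distrib_left[symmetric]) simp
      finally show ?thesis .
    qed
    then show ?thesis by (simp add: sum_distrib_left)
  qed
  ultimately show ?thesis using hb by simp
qed

text \<open>Integrated against the half-strength Gaussian, \<open>(n x) ^ k * x ^ K\<close> has
  order \<open>n powr (- \<nu> - K)\<close> for every \<open>k\<close>, since \<open>n x\<close> is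
  scale invariant.\<close>

lemma laplace_remainder_term:
  fixes a \<nu> :: real
  assumes a: "a > 0" and \<nu>: "\<nu> > 0" and n: "n > 0"
  shows "has_bochner_integral lborel
    (\<lambda>t. indicator {0<..} t * (exp (- a * real n * t\<^sup>2 / 2)
       * (\<Sum>k\<le>K. (real n * t\<^sup>2) ^ k * (t\<^sup>2) ^ K) * t powr (2 * \<nu> - 1)))
    (real n powr (- \<nu>) * (\<Sum>k\<le>K. Gamma (\<nu> + real k + real K) / (2 * (a / 2) powr (\<nu> + real k + real K))) / real n ^ K)"
proof -
  have hb: "has_bochner_integral lborel
    (\<lambda>t. \<Sum>k\<le>K. real n ^ k * (indicator {0<..} t * (exp (- (a * n / 2) * t\<^sup>2) * (t\<^sup>2) ^ (k + K) * t powr (2 * \<nu> - 1))))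
    (\<Sum>k\<le>K. real n ^ k * (Gamma (\<nu> + (k + K)) / (2 * (a * n / 2) powr (\<nu> + (k + K)))))"
    using gaussian_moment_power_has_integral[of "a * n / 2" \<nu>] a n \<nu>
    by (intro has_bochner_integral_sum has_bochner_integral_mult_right) (simp_all del: of_nat_add)
  have "(\<Sum>k\<le>K. real n ^ k * (indicator {0<..} t * (exp (- (a * n / 2) * t\<^sup>2) * (t\<^sup>2) ^ (k + K) * t powr (2 * \<nu> - 1))))
     = indicator {0<..} t * (exp (- a * real n * t\<^sup>2 / 2)
       * (\<Sum>k\<le>K. (real n * t\<^sup>2) ^ k * (t\<^sup>2) ^ K) * t powr (2 * \<nu> - 1))" for t
    unfolding sum_distrib_left sum_distrib_right
    by (intro sum.cong refl) (simp add: power_add power_mult_distrib)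
  moreover have "(\<Sum>k\<le>K. real n ^ k * (Gamma (\<nu> + (k + K)) / (2 * (a * n / 2) powr (\<nu> + (k + K)))))
     = real n powr (- \<nu>) * (\<Sum>k\<le>K. Gamma (\<nu> + real k + real K) / (2 * (a / 2) powr (\<nu> + real k + real K))) / real n ^ K"
    unfolding sum_distrib_left sum_divide_distrib
  proof (intro sum.cong refl)
    fix k
    have "(a * n / 2) powr (\<nu> + (k + K)) = ((a / 2) * n) powr (\<nu> + (k + K))"
      by (simp add: field_simps)
    also have "\<dots> = (a / 2) powr (\<nu> + k + K) * (real n powr \<nu> * real n ^ k * real n ^ K)"
      using a n unfolding powr_mult by (simp add: powr_add powr_realpow add.assoc)
    finally show "real n ^ k * (Gamma (\<nu> + (k + K)) / (2 * (a * n / 2) powr (\<nu> + (k + K))))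
       = real n powr (- \<nu>) * (Gamma (\<nu> + real k + real K) / (2 * (a / 2) powr (\<nu> + real k + real K))) / real n ^ K"
      using a n by (simp add: powr_minus divide_simps add.assoc)
  qed
  ultimately show ?thesis using hb by simp
qed

section \<open>Pointwise error near and far from the origin\<close>

lemma has_fps_expansion_power_real:
  fixes f :: "real \<Rightarrow> real"
  assumes "f has_fps_expansion F"
  shows "(\<lambda>x. f x ^ k) has_fps_expansion F ^ k"
  by (induction k) (auto intro!: has_fps_expansion_mult assms)

lemma divide_fact_le:
  fixes y :: real
  assumes "y \<ge> 0"
  shows "y / fact k \<le> y"
  using mult_left_mono[OF fact_ge_1[of k] assms] by (simp add: divide_le_eq)

text \<open>Two errors add up: cutting off the exponential series, where
  \<open>\<bar>M x\<bar> \<le> B * \<bar>x\<bar>\<close> turns \<open>(n x M x) ^ K\<close> into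
  \<open>(n x) ^ K * x ^ K\<close>, and cutting off the series of each \<open>M ^ k\<close>. The
  neighbourhood of 0 does not depend on \<open>n\<close>; only
  \<open>\<bar>M x\<bar> < a / 2\<close> and finitely many remainder bounds determine it.\<close>

lemma exp_perturbation_bounds:
  fixes M :: "real \<Rightarrow> real" and a :: real
  assumes M: "M has_fps_expansion F" and F0: "fps_nth F 0 = 0" and "a > 0" and "K > 0"
  obtains A where "A \<ge> 0" "\<forall>\<^sub>F x in nhds 0. \<forall>n::nat. 0 \<le> x \<longrightarrow>
     \<bar>exp (real n * x * M x) - (\<Sum>k<K. (real n * x) ^ k / fact k * (\<Sum>i<K. fps_nth (F ^ k) i * x ^ i))\<bar>
       \<le> A * exp (a * real n * x / 2) * (\<Sum>k\<le>K. (real n * x) ^ k * x ^ K)"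
proof -
  have "\<forall>k. \<exists>C. \<forall>\<^sub>F x in nhds 0. \<bar>M x ^ k - (\<Sum>i<K. fps_nth (F ^ k) i * x ^ i)\<bar> \<le> C * \<bar>x\<bar> ^ K"
    by (intro allI fps_expansion_remainder has_fps_expansion_power_real M)
  then obtain C where C: "\<And>k. \<forall>\<^sub>F x in nhds 0. \<bar>M x ^ k - (\<Sum>i<K. fps_nth (F ^ k) i * x ^ i)\<bar> \<le> C k * \<bar>x\<bar> ^ K"
    using choice by meson
  obtain B where B: "\<forall>\<^sub>F x in nhds 0. \<bar>M x\<bar> \<le> B * \<bar>x\<bar>"
  proof -
    obtain B where "\<forall>\<^sub>F x in nhds 0. \<bar>M x - (\<Sum>i<1. fps_nth F i * x ^ i)\<bar> \<le> B * \<bar>x\<bar> ^ 1"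
      using fps_expansion_remainder[OF M] by blast
    then show ?thesis using F0 that by simp
  qed
  have "(M \<longlongrightarrow> M 0) (at 0)"
    using has_fps_expansion_imp_continuous[OF M, of UNIV] by (simp add: continuous_within)
  moreover have "M 0 = 0"
    using eventually_nhds_x_imp_x[OF B] by simp
  ultimately have "(M \<longlongrightarrow> 0) (nhds 0)"
    by (simp add: tendsto_nhds_iff)
  then have small: "\<forall>\<^sub>F x in nhds 0. \<bar>M x\<bar> < a / 2"
    using \<open>a > 0\<close> by (intro order_tendstoD(2)[OF tendsto_rabs_zero]) auto
  have C': "\<forall>\<^sub>F x in nhds 0. \<forall>k\<in>{..<K}. \<bar>M x ^ k - (\<Sum>i<K. fps_nth (F ^ k) i * x ^ i)\<bar> \<le> C k * \<bar>x\<bar> ^ K"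
    by (intro eventually_ball_finite) (use C in auto)
  \<comment> \<open>The first summand pays for the Taylor remainder of \<open>exp\<close>, the
    second for the truncated powers of \<open>M\<close>.\<close>
  define A where "A = \<bar>B\<bar> ^ K + (\<Sum>k<K. \<bar>C k\<bar>)"
  have A0: "A \<ge> 0" by (auto simp: A_def intro!: add_nonneg_nonneg sum_nonneg)
  have CA: "\<bar>C k\<bar> \<le> A" if "k < K" for k
    using member_le_sum[of k "{..<K}" "\<lambda>k. \<bar>C k\<bar>"] that by (auto simp: A_def intro: add_increasing)
  have BA: "\<bar>B\<bar> ^ K \<le> A" by (auto simp: A_def intro!: sum_nonneg)
  have "\<forall>\<^sub>F x in nhds 0. \<forall>n::nat. 0 \<le> x \<longrightarrow>
     \<bar>exp (real n * x * M x) - (\<Sum>k<K. (real n * x) ^ k / fact k * (\<Sum>i<K. fps_nth (F ^ k) i * x ^ i))\<bar>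
       \<le> A * exp (a * real n * x / 2) * (\<Sum>k\<le>K. (real n * x) ^ k * x ^ K)"
    using B small C'
  proof eventually_elim
    case (elim x)
    show ?case
    proof (intro allI impI)
      fix n :: nat assume x: "0 \<le> x"
      define y where "y = real n * x"
      have y: "y \<ge> 0" using x by (simp add: y_def)
      have yM: "\<bar>y * M x\<bar> \<le> a * real n * x / 2"
        using mult_left_mono[of "\<bar>M x\<bar>" "a / 2" y] elim(2) y x by (simp add: abs_mult y_def mult_ac)
      have E1: "exp (a * real n * x / 2) \<ge> 1" using x \<open>a > 0\<close> by simp
      have "\<bar>exp (y * M x) - (\<Sum>k<K. (y * M x) ^ k / fact k)\<bar>
          \<le> exp \<bar>y * M x\<bar> * \<bar>y * M x\<bar> ^ K / fact (K - 1)"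
      proof -
        obtain L where L: "K = Suc L" using \<open>K > 0\<close> gr0_implies_Suc by blast
        show ?thesis
          using Taylor_exp_field[of "y * M x" L] unfolding L lessThan_Suc_atMost by simp
      qed
      also have "\<dots> \<le> exp \<bar>y * M x\<bar> * \<bar>y * M x\<bar> ^ K"
        by (rule divide_fact_le) simp
      also have "\<dots> \<le> exp (a * real n * x / 2) * (y * (\<bar>B\<bar> * x)) ^ K"
      proof (intro mult_mono power_mono)
        have "\<bar>M x\<bar> \<le> \<bar>B\<bar> * x"
          by (rule order_trans[OF _ mult_right_mono[of B "\<bar>B\<bar>" x]]) (use elim(1) x in auto)
        then show "\<bar>y * M x\<bar> \<le> y * (\<bar>B\<bar> * x)"
          using y by (simp add: abs_mult mult_left_mono)
      qed (use yM in auto)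
      also have "\<dots> = \<bar>B\<bar> ^ K * (exp (a * real n * x / 2) * (y ^ K * x ^ K))"
        by (simp add: power_mult_distrib mult_ac)
      also have "\<dots> \<le> A * (exp (a * real n * x / 2) * (y ^ K * x ^ K))"
        by (intro mult_right_mono BA) (use x y in auto)
      finally have 1: "\<bar>exp (y * M x) - (\<Sum>k<K. (y * M x) ^ k / fact k)\<bar>
          \<le> A * (exp (a * real n * x / 2) * (y ^ K * x ^ K))" .
      have summand: "\<bar>(y * M x) ^ k / fact k - y ^ k / fact k * (\<Sum>i<K. fps_nth (F ^ k) i * x ^ i)\<bar>
          \<le> A * (exp (a * real n * x / 2) * (y ^ k * x ^ K))" if "k < K" for k
      proof -
        have "(y * M x) ^ k / fact k - y ^ k / fact k * (\<Sum>i<K. fps_nth (F ^ k) i * x ^ i)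
          = y ^ k / fact k * (M x ^ k - (\<Sum>i<K. fps_nth (F ^ k) i * x ^ i))"
          by (simp add: power_mult_distrib right_diff_distrib)
        then have "\<bar>(y * M x) ^ k / fact k - y ^ k / fact k * (\<Sum>i<K. fps_nth (F ^ k) i * x ^ i)\<bar>
          = y ^ k / fact k * \<bar>M x ^ k - (\<Sum>i<K. fps_nth (F ^ k) i * x ^ i)\<bar>"
          using y by (simp add: abs_mult)
        also have "\<dots> \<le> y ^ k * (A * x ^ K)"
        proof (intro mult_mono)
          show "y ^ k / fact k \<le> y ^ k" by (rule divide_fact_le) (use y in simp)
          have "\<bar>M x ^ k - (\<Sum>i<K. fps_nth (F ^ k) i * x ^ i)\<bar> \<le> C k * x ^ K"
            using elim(3) that x by auto
          also have "\<dots> \<le> A * x ^ K"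
            using CA[OF that] x by (intro mult_right_mono) auto
          finally show "\<bar>M x ^ k - (\<Sum>i<K. fps_nth (F ^ k) i * x ^ i)\<bar> \<le> A * x ^ K" .
        qed (use y in auto)
        also have "\<dots> = 1 * (A * (y ^ k * x ^ K))" by simp
        also have "\<dots> \<le> exp (a * real n * x / 2) * (A * (y ^ k * x ^ K))"
          by (intro mult_right_mono E1) (use A0 x y in auto)
        finally show ?thesis by (simp add: mult_ac)
      qed
      have "\<bar>exp (y * M x) - (\<Sum>k<K. y ^ k / fact k * (\<Sum>i<K. fps_nth (F ^ k) i * x ^ i))\<bar>
        \<le> \<bar>exp (y * M x) - (\<Sum>k<K. (y * M x) ^ k / fact k)\<bar>
         + (\<Sum>k<K. \<bar>(y * M x) ^ k / fact k - y ^ k / fact k * (\<Sum>i<K. fps_nth (F ^ k) i * x ^ i)\<bar>)"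
        using sum_abs[of "\<lambda>k. (y * M x) ^ k / fact k - y ^ k / fact k * (\<Sum>i<K. fps_nth (F ^ k) i * x ^ i)" "{..<K}"]
        by (simp add: sum_subtractf)
      also have "\<dots> \<le> A * (exp (a * real n * x / 2) * (y ^ K * x ^ K))
         + (\<Sum>k<K. A * (exp (a * real n * x / 2) * (y ^ k * x ^ K)))"
        by (intro add_mono 1 sum_mono summand) auto
      also have "\<dots> = A * exp (a * real n * x / 2) * (\<Sum>k\<le>K. y ^ k * x ^ K)"
      proof -
        have "{..K} = insert K {..<K}" by auto
        then show ?thesis by (simp add: sum_distrib_left distrib_left mult.assoc)
      qed
      finally show "\<bar>exp (real n * x * M x) - (\<Sum>k<K. (real n * x) ^ k / fact k * (\<Sum>i<K. fps_nth (F ^ k) i * x ^ i))\<bar>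
       \<le> A * exp (a * real n * x / 2) * (\<Sum>k\<le>K. (real n * x) ^ k * x ^ K)"
        by (simp add: y_def)
    qed
  qed
  with A0 show ?thesis by (rule that)
qed

text \<open>Beyond \<open>\<delta>\<close> each monomial \<open>x ^ i\<close> is dominated by \<open>x ^ K\<close>, so that the polynomial
  terms have the same shape as the remainder near the origin.\<close>
lemma laplace_pointwise:
  fixes g M :: "real \<Rightarrow> real" and a :: real
  assumes M: "M has_fps_expansion F" and F0: "fps_nth F 0 = 0" and a: "a > 0" and K: "K > 0"
    and near: "\<forall>\<^sub>F x in nhds 0. g x = exp (- a * x + x * M x)"
  obtains A \<delta> where "A \<ge> 0" "\<delta> > 0" "\<And>n x. x > 0 \<Longrightarrow>
     \<bar>\<bar>g x\<bar> ^ n - exp (- a * real n * x) * (\<Sum>k<K. (real n * x) ^ k / fact k * (\<Sum>i<K. fps_nth (F ^ k) i * x ^ i))\<bar>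
       \<le> A * exp (- a * real n * x / 2) * (\<Sum>k\<le>K. (real n * x) ^ k * x ^ K) + (if x \<ge> \<delta> then \<bar>g x\<bar> ^ n else 0)"
proof -
  define P where "P = (\<lambda>(n::nat) x. \<Sum>k<K. (real n * x) ^ k / fact k * (\<Sum>i<K. fps_nth (F ^ k) i * x ^ i))"
  define S where "S = (\<lambda>(n::nat) x::real. \<Sum>k\<le>K. (real n * x) ^ k * x ^ K)"
  obtain A where A: "A \<ge> 0" and "\<forall>\<^sub>F x in nhds 0. \<forall>n::nat. 0 \<le> x \<longrightarrow>
     \<bar>exp (real n * x * M x) - P n x\<bar> \<le> A * exp (a * real n * x / 2) * S n x"
    unfolding P_def S_def by (rule exp_perturbation_bounds[OF M F0 a K])
  from near this(2) have "\<forall>\<^sub>F x in nhds 0. g x = exp (- a * x + x * M x) \<and> (\<forall>n::nat. 0 \<le> x \<longrightarrow>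
     \<bar>exp (real n * x * M x) - P n x\<bar> \<le> A * exp (a * real n * x / 2) * S n x)"
    by (rule eventually_conj)
  then obtain \<delta> where \<delta>: "\<delta> > 0" and loc: "\<And>x n. 0 \<le> x \<Longrightarrow> x < \<delta> \<Longrightarrow> g x = exp (- a * x + x * M x)"
     "\<And>x n. 0 \<le> x \<Longrightarrow> x < \<delta> \<Longrightarrow>
     \<bar>exp (real n * x * M x) - P n x\<bar> \<le> A * exp (a * real n * x / 2) * S n x"
    unfolding eventually_nhds_metric by (auto simp: dist_real_def)
  \<comment> \<open>The weights come from \<open>x ^ i \<le> x ^ K / \<delta> ^ (K - i)\<close>,
    valid for \<open>x \<ge> \<delta>\<close>.\<close>
  define A2 where "A2 = (\<Sum>k<K. \<Sum>i<K. \<bar>fps_nth (F ^ k) i\<bar> / \<delta> ^ (K - i))"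
  have A2: "A2 \<ge> 0" unfolding A2_def using \<delta> by (intro sum_nonneg) auto
  have S0: "S n x \<ge> 0" if "x \<ge> 0" for n x
    unfolding S_def using that by (intro sum_nonneg) auto
  have Pfar: "\<bar>P n x\<bar> \<le> A2 * S n x" if x: "x \<ge> \<delta>" for n x
  proof -
    have x0: "x > 0" using x \<delta> by simp
    have mono: "x ^ i \<le> x ^ K / \<delta> ^ (K - i)" if "i < K" for i
    proof -
      have "x ^ i * \<delta> ^ (K - i) \<le> x ^ i * x ^ (K - i)"
        using x \<delta> x0 by (intro mult_left_mono power_mono) auto
      also have "\<dots> = x ^ K" using that by (simp flip: power_add)
      finally show ?thesis using \<delta> by (simp add: field_simps)
    qed
    have "\<bar>P n x\<bar> \<le> (\<Sum>k<K. \<bar>(real n * x) ^ k / fact k * (\<Sum>i<K. fps_nth (F ^ k) i * x ^ i)\<bar>)"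
      unfolding P_def by (rule sum_abs)
    also have "\<dots> \<le> (\<Sum>k<K. (\<Sum>i<K. \<bar>fps_nth (F ^ k) i\<bar> / \<delta> ^ (K - i)) * S n x)"
    proof (rule sum_mono)
      fix k assume k: "k \<in> {..<K}"
      have "\<bar>\<Sum>i<K. fps_nth (F ^ k) i * x ^ i\<bar> \<le> (\<Sum>i<K. \<bar>fps_nth (F ^ k) i * x ^ i\<bar>)"
        by (rule sum_abs)
      also have "\<dots> \<le> (\<Sum>i<K. \<bar>fps_nth (F ^ k) i\<bar> / \<delta> ^ (K - i) * x ^ K)"
      proof (rule sum_mono)
        fix i assume "i \<in> {..<K}"
        then show "\<bar>fps_nth (F ^ k) i * x ^ i\<bar> \<le> \<bar>fps_nth (F ^ k) i\<bar> / \<delta> ^ (K - i) * x ^ K"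
          using mult_left_mono[OF mono[of i], of "\<bar>fps_nth (F ^ k) i\<bar>"] x0 by (simp add: abs_mult)
      qed
      also have "\<dots> = (\<Sum>i<K. \<bar>fps_nth (F ^ k) i\<bar> / \<delta> ^ (K - i)) * x ^ K"
        by (simp add: sum_distrib_right)
      finally have *: "\<bar>\<Sum>i<K. fps_nth (F ^ k) i * x ^ i\<bar> \<le> (\<Sum>i<K. \<bar>fps_nth (F ^ k) i\<bar> / \<delta> ^ (K - i)) * x ^ K" .
      have "\<bar>(real n * x) ^ k / fact k * (\<Sum>i<K. fps_nth (F ^ k) i * x ^ i)\<bar>
         = (real n * x) ^ k / fact k * \<bar>\<Sum>i<K. fps_nth (F ^ k) i * x ^ i\<bar>"
        using x0 by (simp add: abs_mult)
      also have "\<dots> \<le> (real n * x) ^ k * ((\<Sum>i<K. \<bar>fps_nth (F ^ k) i\<bar> / \<delta> ^ (K - i)) * x ^ K)"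
        by (intro mult_mono * divide_fact_le) (use x0 in auto)
      also have "\<dots> = (\<Sum>i<K. \<bar>fps_nth (F ^ k) i\<bar> / \<delta> ^ (K - i)) * ((real n * x) ^ k * x ^ K)"
        by simp
      also have "\<dots> \<le> (\<Sum>i<K. \<bar>fps_nth (F ^ k) i\<bar> / \<delta> ^ (K - i)) * S n x"
      proof (rule mult_left_mono)
        show "(real n * x) ^ k * x ^ K \<le> S n x"
          unfolding S_def using k x0 by (intro member_le_sum) auto
      qed (use \<delta> in \<open>auto intro!: sum_nonneg\<close>)
      finally show "\<bar>(real n * x) ^ k / fact k * (\<Sum>i<K. fps_nth (F ^ k) i * x ^ i)\<bar>
        \<le> (\<Sum>i<K. \<bar>fps_nth (F ^ k) i\<bar> / \<delta> ^ (K - i)) * S n x" .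
    qed
    also have "\<dots> = A2 * S n x" by (simp add: A2_def sum_distrib_right)
    finally show ?thesis .
  qed
  have "\<bar>\<bar>g x\<bar> ^ n - exp (- a * real n * x) * P n x\<bar>
      \<le> (A + A2) * exp (- a * real n * x / 2) * S n x + (if x \<ge> \<delta> then \<bar>g x\<bar> ^ n else 0)"
    if x: "x > 0" for n x
  proof (cases "x \<ge> \<delta>")
    case True
    have "\<bar>\<bar>g x\<bar> ^ n - exp (- a * real n * x) * P n x\<bar> \<le> \<bar>g x\<bar> ^ n + exp (- a * real n * x) * \<bar>P n x\<bar>"
      by (rule order_trans[OF abs_triangle_ineq4]) (simp add: abs_mult)
    \<comment> \<open>Here the Gaussian is simply weakened to half strength, to match the error near
      the origin.\<close>
    moreover have "exp (- a * real n * x) * \<bar>P n x\<bar> \<le> exp (- a * real n * x / 2) * ((A + A2) * S n x)"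
    proof (rule mult_mono)
      show "\<bar>P n x\<bar> \<le> (A + A2) * S n x"
        using Pfar[OF True, of n] S0[of x n] x A by (simp add: distrib_right add_increasing)
    qed (use x a in auto)
    ultimately show ?thesis using True by (simp add: mult_ac)
  next
    case False
    have "\<bar>g x\<bar> ^ n = exp (- a * real n * x) * exp (real n * x * M x)"
    proof -
      have "\<bar>g x\<bar> ^ n = exp (real n * (- a * x + x * M x))"
        using loc(1)[of x] False x by (simp add: exp_of_nat_mult)
      also have "real n * (- a * x + x * M x) = (- a * real n * x) + real n * x * M x"
        by (simp add: algebra_simps)
      finally show ?thesis by (simp only: exp_add)
    qed
    then have "\<bar>\<bar>g x\<bar> ^ n - exp (- a * real n * x) * P n x\<bar>
       = exp (- a * real n * x) * \<bar>exp (real n * x * M x) - P n x\<bar>"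
      by (simp add: abs_mult flip: right_diff_distrib)
    also have "\<dots> \<le> exp (- a * real n * x) * (A * exp (a * real n * x / 2) * S n x)"
      using loc(2)[of x n] False x by (intro mult_left_mono) auto
    also have "\<dots> = A * exp (- a * real n * x / 2) * S n x"
    proof -
      have "exp (- a * real n * x) * exp (a * real n * x / 2) = exp (- a * real n * x / 2)"
        unfolding exp_add[symmetric] by simp
      then show ?thesis by simp
    qed
    also have "\<dots> \<le> (A + A2) * exp (- a * real n * x / 2) * S n x"
      using A2 S0[of x n] x by (intro mult_right_mono) auto
    finally show ?thesis using False by simp
  qed
  then show ?thesis
    using A A2 \<delta> by (intro that[of "A + A2" \<delta>]) (simp_all only: P_def S_def add_nonneg_nonneg)
qed

text \<open>The difference between integrand and main term is dominated by an integrable function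
  whose integral is explicit. This proves integrability of the integrand and the error bound
  together.\<close>

lemma laplace_expansion:
  fixes g M :: "real \<Rightarrow> real" and a \<nu> B :: real
  assumes M: "M has_fps_expansion F" and F0: "fps_nth F 0 = 0" and a: "a > 0" and K: "K > 0" and \<nu>: "\<nu> > 0"
    and near: "\<forall>\<^sub>F x in nhds 0. g x = exp (- a * x + x * M x)"
    and meas[measurable]: "g \<in> borel_measurable borel"
    and far: "\<And>\<delta>. \<delta> > 0 \<Longrightarrow> \<exists>q<1. \<forall>x\<ge>\<delta>. \<bar>g x\<bar> \<le> q"
    and decay: "\<And>x. x > 0 \<Longrightarrow> x * (g x)\<^sup>2 \<le> B"
  obtains C where "\<forall>\<^sub>F n in sequentially. norm (real n powr \<nu> * (LINT t:{0<..}|lborel. \<bar>g (t\<^sup>2)\<bar> ^ n * t powr (2 * \<nu> - 1))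
      - (\<Sum>i<K. laplace_coeff a \<nu> F i / real n ^ i)) \<le> C * norm (1 / real n ^ K)"
proof -
  define P where "P = (\<lambda>(n::nat) x. \<Sum>k<K. (real n * x) ^ k / fact k * (\<Sum>i<K. fps_nth (F ^ k) i * x ^ i))"
  define S where "S = (\<lambda>(n::nat) x::real. \<Sum>k\<le>K. (real n * x) ^ k * x ^ K)"
  obtain A \<delta> where A: "A \<ge> 0" and \<delta>: "\<delta> > 0" and pw: "\<And>n x. x > 0 \<Longrightarrow>
     \<bar>\<bar>g x\<bar> ^ n - exp (- a * real n * x) * P n x\<bar>
       \<le> A * exp (- a * real n * x / 2) * S n x + (if x \<ge> \<delta> then \<bar>g x\<bar> ^ n else 0)"
    by (rule laplace_pointwise[OF M F0 a K near], rule that, assumption, assumption)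
      (simp only: P_def S_def)
  obtain q0 where q0: "q0 < 1" "\<forall>x\<ge>\<delta>. \<bar>g x\<bar> \<le> q0"
    using far[OF \<delta>] by blast
  \<comment> \<open>The bound \<open>q0\<close> could be 0; a positive \<open>q\<close> is needed
    for dividing by \<open>q ^ (2 * p)\<close>.\<close>
  define q where "q = max q0 (1 / 2)"
  have q: "0 < q" "q < 1" and gq: "\<And>x. x \<ge> \<delta> \<Longrightarrow> \<bar>g x\<bar> \<le> q"
    using q0 by (auto simp: q_def le_max_iff_disj)
  have B: "B \<ge> 0"
    by (rule order_trans[OF _ decay[of 1]]) auto
  \<comment> \<open>The number of factors \<open>g\<^sup>2\<close> spent on decay: replacing each by
    \<open>B / t\<^sup>2\<close> lowers the exponent \<open>2 \<nu> - 1\<close> by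
    \<open>2 p\<close>, and \<open>p > \<nu>\<close> brings it below -1.\<close>
  define p where "p = nat \<lceil>\<nu> + 1 / 2\<rceil> + 1"
  define e where "e = 2 * \<nu> - 1 - 2 * real p"
  have e: "e < -1"
    using of_nat_ceiling[of "\<nu> + 1 / 2"] by (simp add: e_def p_def)
  define J where "J = (LINT t:{sqrt \<delta>..}|lborel. t powr e)"
  have J: "has_bochner_integral lborel (\<lambda>t. indicator {sqrt \<delta>..} t * t powr e) J"
    using set_integrable_powr_to_inf[of "sqrt \<delta>" e] \<delta> e
    by (simp add: J_def has_bochner_integral_iff set_integrable_def set_lebesgue_integral_def)
  define G where "G = (\<Sum>k\<le>K. Gamma (\<nu> + real k + real K) / (2 * (a / 2) powr (\<nu> + real k + real K)))"
  define f where "f = (\<lambda>n t. indicator {0<..} t * (\<bar>g (t\<^sup>2)\<bar> ^ n * t powr (2 * \<nu> - 1)))"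
  define main where "main = (\<lambda>n t. indicator {0<..} t * (exp (- a * real n * t\<^sup>2) * P n (t\<^sup>2) * t powr (2 * \<nu> - 1)))"
  \<comment> \<open>The first summand integrates to order \<open>n powr (- \<nu> - K)\<close>; the
    second, coming from \<open>t\<^sup>2 \<ge> \<delta>\<close>, is geometrically small in
    \<open>n\<close>.\<close>
  define U where "U = (\<lambda>n t. A * (indicator {0<..} t * (exp (- a * real n * t\<^sup>2 / 2) * S n (t\<^sup>2) * t powr (2 * \<nu> - 1)))
      + q ^ (n - 2 * p) * B ^ p * (indicator {sqrt \<delta>..} t * t powr e))"
  have far_bound: "\<bar>g (t\<^sup>2)\<bar> ^ n * t powr (2 * \<nu> - 1) \<le> q ^ (n - 2 * p) * B ^ p * t powr e"
    if t: "t > 0" "t\<^sup>2 \<ge> \<delta>" and n: "n \<ge> 2 * p" for n t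
  proof -
    have "\<bar>g (t\<^sup>2)\<bar> ^ n = \<bar>g (t\<^sup>2)\<bar> ^ (n - 2 * p) * ((g (t\<^sup>2))\<^sup>2) ^ p"
      using n power_add[of "\<bar>g (t\<^sup>2)\<bar>" "n - 2 * p" "2 * p"] by (simp add: power_mult)
    also have "\<dots> \<le> q ^ (n - 2 * p) * (B / t\<^sup>2) ^ p"
      using gq[OF t(2)] decay[of "t\<^sup>2"] t q
      by (intro mult_mono power_mono) (auto simp: field_simps)
    also have "\<dots> = q ^ (n - 2 * p) * B ^ p * t powr (- 2 * real p)"
    proof -
      have "(t\<^sup>2) ^ p = t powr (2 * real p)"
        using t powr_realpow[of t "2 * p"] by (simp add: power_mult)
      then show ?thesis by (simp add: power_divide powr_minus_divide)
    qed
    finally have "\<bar>g (t\<^sup>2)\<bar> ^ n * t powr (2 * \<nu> - 1) \<le> q ^ (n - 2 * p) * B ^ p * t powr (- 2 * real p) * t powr (2 * \<nu> - 1)"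
      by (rule mult_right_mono) auto
    also have "\<dots> = q ^ (n - 2 * p) * B ^ p * t powr e"
      by (simp add: e_def mult.assoc flip: powr_add)
    finally show ?thesis .
  qed
  have diff_bound: "\<bar>f n t - main n t\<bar> \<le> U n t" if n: "n \<ge> 2 * p" for n t
  proof (cases "t > 0")
    case t: True
    have "\<bar>f n t - main n t\<bar> = \<bar>\<bar>g (t\<^sup>2)\<bar> ^ n - exp (- a * real n * t\<^sup>2) * P n (t\<^sup>2)\<bar> * t powr (2 * \<nu> - 1)"
      using t by (simp add: f_def main_def abs_mult flip: left_diff_distrib)
    also have "\<dots> \<le> (A * exp (- a * real n * t\<^sup>2 / 2) * S n (t\<^sup>2) + (if t\<^sup>2 \<ge> \<delta> then \<bar>g (t\<^sup>2)\<bar> ^ n else 0)) * t powr (2 * \<nu> - 1)"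
      using t by (intro mult_right_mono pw) auto
    also have "\<dots> = A * (indicator {0<..} t * (exp (- a * real n * t\<^sup>2 / 2) * S n (t\<^sup>2) * t powr (2 * \<nu> - 1)))
       + (if t\<^sup>2 \<ge> \<delta> then \<bar>g (t\<^sup>2)\<bar> ^ n * t powr (2 * \<nu> - 1) else 0)"
      using t by (simp add: distrib_right mult.assoc)
    also have "\<dots> \<le> U n t"
    proof -
      have "t\<^sup>2 \<ge> \<delta> \<longleftrightarrow> t \<in> {sqrt \<delta>..}"
        using t real_sqrt_le_iff[of \<delta> "t\<^sup>2"] by simp
      then show ?thesis
        using far_bound[OF t _ n] q B unfolding U_def by (auto simp: indicator_def)
    qed
    finally show ?thesis .
  next
    case False
    then show ?thesis
      using q B by (auto simp: f_def main_def U_def intro!: mult_nonneg_nonneg)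
  qed
  have int_main: "has_bochner_integral lborel (main n) (real n powr (- \<nu>) * (\<Sum>i<K. laplace_coeff a \<nu> F i / real n ^ i))"
    if "n > 0" for n
    using laplace_main_term[OF F0 a \<nu> that, of K] by (simp add: main_def P_def)
  have int_U: "has_bochner_integral lborel (U n)
     (A * (real n powr (- \<nu>) * G / real n ^ K) + q ^ (n - 2 * p) * B ^ p * J)" if "n > 0" for n
    unfolding U_def
  proof (intro has_bochner_integral_add has_bochner_integral_mult_right)
    show "has_bochner_integral lborel
      (\<lambda>t. indicator {0<..} t * (exp (- a * real n * t\<^sup>2 / 2) * S n (t\<^sup>2) * t powr (2 * \<nu> - 1)))
      (real n powr (- \<nu>) * G / real n ^ K)"
      using laplace_remainder_term[OF a \<nu> that, of K] by (simp add: S_def G_def)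
  qed (rule J)
  have key: "\<bar>(LINT t:{0<..}|lborel. \<bar>g (t\<^sup>2)\<bar> ^ n * t powr (2 * \<nu> - 1))
       - real n powr (- \<nu>) * (\<Sum>i<K. laplace_coeff a \<nu> F i / real n ^ i)\<bar>
     \<le> A * (real n powr (- \<nu>) * G / real n ^ K) + q ^ (n - 2 * p) * B ^ p * J"
    if n: "n > 0" "n \<ge> 2 * p" for n
  proof -
    have iU: "integrable lborel (U n)" and im: "integrable lborel (main n)"
      using int_U[OF n(1)] int_main[OF n(1)] by (auto simp: has_bochner_integral_iff)
    have [measurable]: "f n \<in> borel_measurable lborel" by (simp add: f_def)
    \<comment> \<open>Nothing is known yet about the integral of \<open>f n\<close>; its
      integrability comes from this dominated difference together with that of
      \<open>main n\<close>.\<close>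
    have id: "integrable lborel (\<lambda>t. f n t - main n t)"
      using im by (intro Bochner_Integration.integrable_bound[OF iU])
        (auto intro!: AE_I2 order_trans[OF diff_bound[OF n(2)]] borel_measurable_diff borel_measurable_integrable)
    have "integrable lborel (\<lambda>t. (f n t - main n t) + main n t)"
      by (intro Bochner_Integration.integrable_add id im)
    then have if_: "integrable lborel (f n)" by simp
    have "\<bar>integral\<^sup>L lborel (f n) - integral\<^sup>L lborel (main n)\<bar> = \<bar>integral\<^sup>L lborel (\<lambda>t. f n t - main n t)\<bar>"
      using if_ im by simp
    also have "\<dots> \<le> integral\<^sup>L lborel (\<lambda>t. \<bar>f n t - main n t\<bar>)"
      by (rule integral_abs_bound)
    also have "\<dots> \<le> integral\<^sup>L lborel (U n)"
      by (intro integral_mono diff_bound n iU integrable_abs id)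
    finally show ?thesis
      using int_U[OF n(1)] int_main[OF n(1)]
      by (simp add: has_bochner_integral_iff f_def set_lebesgue_integral_def)
  qed
  \<comment> \<open>An integer exponent with \<open>n powr \<nu> \<le> n ^ L\<close>; the extra
    \<open>K\<close> in \<open>L + K\<close> supplies the factor \<open>1 / n ^ K\<close> for the
    geometric part.\<close>
  define L where "L = nat \<lceil>\<nu>\<rceil>"
  obtain C where C: "C \<ge> 0" "\<And>n. real n ^ (L + K) * q ^ n \<le> C"
    using power_times_geometric_bounded[OF q] by blast
  have J0: "J \<ge> 0"
    using J unfolding has_bochner_integral_iff by (auto intro!: integral_nonneg_AE)
  show ?thesis
  proof (rule that[of "A * G + C / q ^ (2 * p) * B ^ p * J"])
    show "\<forall>\<^sub>F n in sequentially. norm (real n powr \<nu> * (LINT t:{0<..}|lborel. \<bar>g (t\<^sup>2)\<bar> ^ n * t powr (2 * \<nu> - 1))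
      - (\<Sum>i<K. laplace_coeff a \<nu> F i / real n ^ i))
      \<le> (A * G + C / q ^ (2 * p) * B ^ p * J) * norm (1 / real n ^ K)"
      using eventually_gt_at_top[of 0] eventually_ge_at_top[of "2 * p"]
    proof eventually_elim
      case (elim n)
      let ?I = "LINT t:{0<..}|lborel. \<bar>g (t\<^sup>2)\<bar> ^ n * t powr (2 * \<nu> - 1)"
      let ?s = "\<Sum>i<K. laplace_coeff a \<nu> F i / real n ^ i"
      have n: "real n > 0" using elim by simp
      have nn: "real n powr \<nu> * real n powr (- \<nu>) = 1"
        using n by (simp flip: powr_add)
      have "real n powr \<nu> * ?I - ?s = real n powr \<nu> * (?I - real n powr (- \<nu>) * ?s)"
        using nn by (simp add: right_diff_distrib flip: mult.assoc)
      then have "norm (real n powr \<nu> * ?I - ?s) = real n powr \<nu> * \<bar>?I - real n powr (- \<nu>) * ?s\<bar>"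
        by (simp add: abs_mult)
      also have "\<dots> \<le> real n powr \<nu> * (A * (real n powr (- \<nu>) * G / real n ^ K) + q ^ (n - 2 * p) * B ^ p * J)"
        by (intro mult_left_mono key elim) auto
      also have "\<dots> = (real n powr \<nu> * real n powr (- \<nu>)) * (A * G / real n ^ K) + (real n powr \<nu> * q ^ (n - 2 * p)) * (B ^ p * J)"
        by (simp add: distrib_left mult_ac)
      also have "\<dots> \<le> A * G / real n ^ K + (C / q ^ (2 * p) / real n ^ K) * (B ^ p * J)"
      proof (intro add_mono mult_right_mono)
        have "real n powr \<nu> \<le> real n powr real L"
          using elim unfolding L_def by (intro powr_mono) linarith+
        then have "real n powr \<nu> * q ^ (n - 2 * p) \<le> real n ^ L * (q ^ n / q ^ (2 * p))"
          using elim q n by (intro mult_mono) (auto simp: powr_realpow power_diff)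
        also have "\<dots> = (real n ^ (L + K) * q ^ n) / q ^ (2 * p) / real n ^ K"
          using n by (simp add: power_add)
        also have "\<dots> \<le> C / q ^ (2 * p) / real n ^ K"
          using C n q by (intro divide_right_mono) auto
        finally show "real n powr \<nu> * q ^ (n - 2 * p) \<le> C / q ^ (2 * p) / real n ^ K" .
      qed (use nn B J0 in auto)
      also have "\<dots> = (A * G + C / q ^ (2 * p) * B ^ p * J) * norm (1 / real n ^ K)"
        by (simp add: add_divide_distrib mult_ac)
      finally show ?case .
    qed
  qed
qed

section \<open>The expansion of the Bessel integral\<close>

lemma bessel_laplace_expansion:
  assumes "\<nu> \<ge> 1 / 2" "K > 0"
  shows "(\<lambda>n. bessel_power_integral \<nu> n
      - (\<Sum>i<K. laplace_coeff (1 / (4 * (\<nu> + 1))) \<nu> (bessel_log_fps \<nu>) i / real n ^ i))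
     \<in> O(\<lambda>n. 1 / real n ^ K)"
proof -
  have \<nu>: "\<nu> > 0" using assms by simp
  define a where "a = 1 / (4 * (\<nu> + 1))"
  define Q where "Q = log_quotient_fps (bessel_fps \<nu>)"
  have rad: "fps_conv_radius (bessel_fps \<nu>) > 0"
    by (simp add: fps_conv_radius_bessel_fps[OF \<nu>])
  note Q = log_quotient_fps_expansion[OF rad bessel_fps_0, folded Q_def]
  have "continuous_on UNIV (bessel_g \<nu>)"
    unfolding bessel_g_def
    by (intro continuous_at_imp_continuous_on ballI continuous_eval_fps)
      (simp add: fps_conv_radius_bessel_fps[OF \<nu>])
  then have meas: "bessel_g \<nu> \<in> borel_measurable borel"
    by (rule borel_measurable_continuous_onI)
  have M: "(\<lambda>x. a + eval_fps Q x) has_fps_expansion bessel_log_fps \<nu>"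
    unfolding bessel_log_fps_def a_def Q_def
    by (intro has_fps_expansion_add has_fps_expansion_const eval_fps_has_fps_expansion Q(1)[unfolded Q_def])
  have near: "\<forall>\<^sub>F x in nhds 0. bessel_g \<nu> x = exp (- a * x + x * (a + eval_fps Q x))"
    using Q(2) by eventually_elim (simp add: bessel_g_def algebra_simps)
  show ?thesis
    unfolding bessel_power_integral_eq[OF \<nu>] a_def[symmetric]
    by (rule laplace_expansion[OF M bessel_log_fps_nth(1)[OF \<nu>] _ assms(2) \<nu> near meas
          bessel_g_bounded_away_from_1[OF \<nu>] bessel_g_decay[OF assms(1)]])
      (use \<nu> in \<open>simp_all add: a_def bigoI\<close>)
qed

theorem mainTheorem2:
  fixes \<nu> :: real and m :: nat
  assumes "\<nu> \<ge> 1 / 2" and "m \<ge> 3"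
  shows "\<exists>c :: nat \<Rightarrow> real.
    (\<lambda>n :: nat. bessel_power_integral \<nu> n -
       (coeff0 \<nu> + coeff1 \<nu> / real n + coeff2 \<nu> / real n ^ 2 + coeff3 \<nu> / real n ^ 3
        + (\<Sum>j = 4..m. c j / real n ^ j)))
    \<in> O[at_top](\<lambda>n. 1 / real n ^ (m + 1))"
proof (rule exI)
  have \<nu>: "\<nu> > 0" using assms by simp
  \<comment> \<open>The whole coefficient sequence serves as witness. An error of order
    \<open>m + 1\<close> requires the truncation \<open>K = m + 1\<close>, that is, the indices 0 to
    \<open>m\<close>, of which the first four have closed forms.\<close>
  let ?c = "laplace_coeff (1 / (4 * (\<nu> + 1))) \<nu> (bessel_log_fps \<nu>)"
  have "{..<m + 1} = {0, 1, 2, 3} \<union> {4..m}" using assms(2) by auto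
  then have "(\<Sum>i<m + 1. ?c i / real n ^ i)
      = coeff0 \<nu> + coeff1 \<nu> / real n + coeff2 \<nu> / real n ^ 2 + coeff3 \<nu> / real n ^ 3
        + (\<Sum>j = 4..m. ?c j / real n ^ j)" for n
    using bessel_laplace_coeff[OF \<nu>] by (simp add: sum.union_disjoint)
  then show "(\<lambda>n :: nat. bessel_power_integral \<nu> n -
       (coeff0 \<nu> + coeff1 \<nu> / real n + coeff2 \<nu> / real n ^ 2 + coeff3 \<nu> / real n ^ 3
        + (\<Sum>j = 4..m. ?c j / real n ^ j)))
    \<in> O[at_top](\<lambda>n. 1 / real n ^ (m + 1))"
    using bessel_laplace_expansion[OF assms(1), of "m + 1"] by simp
qed

end
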